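(* Let $\mathcal{P}$ and $\mathcal{P}_n$, $n=1,2,\ldots$, be pyramids and let $\kappa>0$ be a real number. If $\mathcal{P}_n$ converges weakly to $\mathcal{P}$ as $n\to\infty$, then $$\operatorname{ObsDiam}(\mathcal{P};-\kappa)=\lim_{\varepsilon\to 0+}\liminf_{n\to\infty}\operatorname{ObsDiam}(\mathcal{P}_n;-(\kappa+\varepsilon))=\lim_{\varepsilon\to 0+}\limsup_{n\to\infty}\operatorname{ObsDiam}(\mathcal{P}_n;-(\kappa+\varepsilon)).$$
   Context: An mm-space is a triple $(X,d_X,\mu_X)$ (written $X$) where $d_X$ is a complete separable metric on $X$ and $\mu_X$ is a Borel probability measure on $(X,d_X)$ with full support. Two mm-spaces $X,Y$ are mm-isomorphic if there is an isometry $f\colon X\to Y$ (onto) with $f_*\mu_X=\mu_Y$, where $f_*\mu_X$ denotes the push-forward. $\mathcal{X}$ denotes the set of mm-isomorphism classes of mm-spaces. A map $f\colon X\to Y$ of metric spaces is 1-Lipschitz if $d_Y(f(x),f(y))\le d_X(x,y)$ for all $x,y$; $\operatorname{Lip}_1(X)$ is the set of 1-Lipschitz functions $X\to\mathbb{R}$. For mm-spaces $X,Y$, write $Y\prec X$ if there is a 1-Lipschitz map $f\colon X\to Y$ with $f_*\mu_X=\mu_Y$. Box distance: a parameter of $X$ is a Borel measurable map $\varphi\colon[0,1]\to X$ with $\varphi_*\lambda=\mu_X$, where $\lambda$ is Lebesgue measure on $[0,1]$. $\Box(X,Y)$ is the infimum of all $\varepsilon\ge 0$ for which there exist parameters $\varphi$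 of $X$ and $\psi$ of $Y$ and a Borel set $I_0\subset[0,1]$ with $\lambda(I_0)\ge 1-\varepsilon$ and $|d_X(\varphi(s),\varphi(t))-d_Y(\psi(s),\psi(t))|\le\varepsilon$ for all $s,t\in I_0$. This is a metric on $\mathcal{X}$. A pyramid is a non-empty, $\Box$-closed subset $\mathcal{P}\subset\mathcal{X}$ such that (1) if $Y\in\mathcal{P}$, $X\in\mathcal{X}$ and $X\prec Y$, then $X\in\mathcal{P}$; (2) for any $X,Y\in\mathcal{P}$ there is $Z\in\mathcal{P}$ with $X\prec Z$ and $Y\prec Z$. Weak convergence: pyramids $\mathcal{P}_n$ converge weakly to a pyramid $\mathcal{P}$ if (i) $\lim_{n\to\infty}\Box(X,\mathcal{P}_n)=0$ for every $X\in\mathcal{P}$, and (ii) $\liminf_{n\to\infty}\Box(X,\mathcal{P}_n)>0$ for every $X\in\mathcal{X}\setminus\mathcal{P}$, where $\Box(X,\mathcal{P}_n)=\inf_{Y\in\mathcal{P}_n}\Box(X,Y)$. For a Borel probability measure $\mu$ on a metric space $Y$ and a real number $\alpha\le 1$, the partial diameter $\operatorname{PartDiam}(\mu;\alpha)\in[0,\infty]$ is the infimum of the diameters of all Borel subsets $A\subset Y$ with $\mu(A)\ge\alpha$ (with $\operatorname{diam}\emptyset=0$). For an mm-space $X$ and $\kappa\ge 0$, $\operatorname{ObsDiam}(X;-\kappa)=\sup\{\operatorname{PartDiam}(f_*\mu_X;1-\kappa)\mid f\in\operatorname{Lip}_1(X)\}$. For a pyramid $\mathcal{P}$ and $\kappa\ge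 0$, $\operatorname{ObsDiam}(\mathcal{P};-\kappa)=\sup\{\operatorname{ObsDiam}(X;-\kappa)\mid X\in\mathcal{P}\}\in[0,\infty]$. *)

theory Defs
  imports "HOL-Probability.Probability"
begin

section \<open>Metric measure spaces\<close>

definition borel_of :: "'a topology \<Rightarrow> 'a measure" where
  "borel_of T = sigma (topspace T) {U. openin T U}"

datatype 'a mm_data = MM (mm_metric: "'a metric") (mm_measure: "'a measure")

abbreviation mm_carrier :: "'a mm_data \<Rightarrow> 'a set" where
  "mm_carrier X \<equiv> mspace (mm_metric X)"

abbreviation mm_dist :: "'a mm_data \<Rightarrow> 'a \<Rightarrow> 'a \<Rightarrow> real" where
  "mm_dist X \<equiv> mdist (mm_metric X)"

abbreviation mm_topology :: "'a mm_data \<Rightarrow> 'a topology" where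
  "mm_topology X \<equiv> mtopology_of (mm_metric X)"

definition mm_space :: "'a mm_data \<Rightarrow> bool" where
  "mm_space X \<longleftrightarrow>
     mcomplete_of (mm_metric X) \<and>
     separable_space (mm_topology X) \<and>
     sets (mm_measure X) = sets (borel_of (mm_topology X)) \<and>
     prob_space (mm_measure X) \<and>
     (\<forall>U. openin (mm_topology X) U \<and> U \<noteq> {} \<longrightarrow> 0 < emeasure (mm_measure X) U)"

text \<open>For a map that is not measurable, \<^const>\<open>distr\<close> is not the push-forward. Below it is only applied
  to 1-Lipschitz maps and isometries, which are continuous and hence measurable between mm-spaces
  (lemma \<open>lipschitz1_measurable\<close>).\<close>

definition mm_isomorphic :: "'a mm_data \<Rightarrow> 'b mm_data \<Rightarrow> bool" where
  "mm_isomorphic X Y \<longleftrightarrow>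
     (\<exists>f. f ` mm_carrier X = mm_carrier Y \<and>
          (\<forall>x\<in>mm_carrier X. \<forall>y\<in>mm_carrier X. mm_dist Y (f x) (f y) = mm_dist X x y) \<and>
          distr (mm_measure X) (mm_measure Y) f = mm_measure Y)"

definition lipschitz1 :: "'a metric \<Rightarrow> 'b metric \<Rightarrow> ('a \<Rightarrow> 'b) set" where
  "lipschitz1 m m' = {f. f \<in> mspace m \<rightarrow> mspace m' \<and>
     (\<forall>x\<in>mspace m. \<forall>y\<in>mspace m. mdist m' (f x) (f y) \<le> mdist m x y)}"

text \<open>\<open>lip_dominated Y X\<close> is the relation written \<open>Y \<prec> X\<close>.\<close>

definition lip_dominated :: "'a mm_data \<Rightarrow> 'b mm_data \<Rightarrow> bool" where
  "lip_dominated Y X \<longleftrightarrow>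
     (\<exists>f \<in> lipschitz1 (mm_metric X) (mm_metric Y).
        distr (mm_measure X) (mm_measure Y) f = mm_measure Y)"


section \<open>Box distance\<close>

abbreviation lborel_01 :: "real measure" where
  "lborel_01 \<equiv> restrict_space lborel {0..1}"

definition mm_parameter :: "'a mm_data \<Rightarrow> (real \<Rightarrow> 'a) \<Rightarrow> bool" where
  "mm_parameter X \<phi> \<longleftrightarrow>
     \<phi> \<in> lborel_01 \<rightarrow>\<^sub>M mm_measure X \<and> distr lborel_01 (mm_measure X) \<phi> = mm_measure X"

definition box_close :: "'a mm_data \<Rightarrow> 'b mm_data \<Rightarrow> real \<Rightarrow> bool" where
  "box_close X Y \<epsilon> \<longleftrightarrow>
     (\<exists>\<phi> \<psi> I. mm_parameter X \<phi> \<and> mm_parameter Y \<psi> \<and>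
        I \<in> sets borel \<and> I \<subseteq> {0..1} \<and> 1 - \<epsilon> \<le> measure lborel I \<and>
        (\<forall>s\<in>I. \<forall>t\<in>I. \<bar>mm_dist X (\<phi> s) (\<phi> t) - mm_dist Y (\<psi> s) (\<psi> t)\<bar> \<le> \<epsilon>))"

definition box_dist_data :: "'a mm_data \<Rightarrow> 'b mm_data \<Rightarrow> ennreal" where
  "box_dist_data X Y = (INF \<epsilon>\<in>{\<epsilon>. 0 \<le> \<epsilon> \<and> box_close X Y \<epsilon>}. ennreal \<epsilon>)"


section \<open>Partial and observable diameter\<close>

text \<open>Suprema in \<^typ>\<open>ennreal\<close> make the diameter of an unbounded set infinite and that of the
  empty set zero.\<close>

definition ediam :: "'a metric \<Rightarrow> 'a set \<Rightarrow> ennreal" where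
  "ediam m A = (SUP x\<in>A. SUP y\<in>A. ennreal (mdist m x y))"

definition part_diam :: "'a metric \<Rightarrow> 'a measure \<Rightarrow> real \<Rightarrow> ennreal" where
  "part_diam m \<nu> \<alpha> = (INF A\<in>{A \<in> sets \<nu>. \<alpha> \<le> measure \<nu> A}. ediam m A)"

text \<open>The argument \<open>\<kappa>\<close> of the following function, and of \<open>pyramid_obs_diam\<close> below, corresponds to
  the notation \<open>ObsDiam(X; -\<kappa>)\<close>.\<close>

definition obs_diam_data :: "'a mm_data \<Rightarrow> real \<Rightarrow> ennreal" where
  "obs_diam_data X \<kappa> =
     (SUP f\<in>lipschitz1 (mm_metric X) (euclidean_metric :: real metric).
        part_diam euclidean_metric (distr (mm_measure X) borel f) (1 - \<kappa>))"


section \<open>Invariance under mm-isomorphism\<close>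

lemma space_mm_measure:
  assumes "mm_space X"
  shows "space (mm_measure X) = mm_carrier X"
proof -
  have "{U. openin (mm_topology X) U} \<subseteq> Pow (mm_carrier X)"
    by (metis CollectD PowI openin_subset subsetI topspace_mtopology_of)
  then have "space (borel_of (mm_topology X)) = mm_carrier X"
    by (simp add: borel_of_def space_measure_of)
  then show ?thesis
    using sets_eq_imp_space_eq[of "mm_measure X" "borel_of (mm_topology X)"] assms
    by (simp add: mm_space_def)
qed

lemma sets_mm_measure:
  assumes "mm_space X"
  shows "sets (mm_measure X) = sigma_sets (mm_carrier X) {U. openin (mm_topology X) U}"
proof -
  have "{U. openin (mm_topology X) U} \<subseteq> Pow (mm_carrier X)"
    by (metis CollectD PowI openin_subset subsetI topspace_mtopology_of)
  then show ?thesis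
    using assms by (simp add: mm_space_def borel_of_def sets_measure_of)
qed

lemma lipschitz1_continuous:
  assumes "f \<in> lipschitz1 m m'"
  shows "continuous_map (mtopology_of m) (mtopology_of m') f"
proof (rule Lipschitz_continuous_imp_continuous_map)
  have "f \<in> mspace m \<rightarrow> mspace m'"
    and "\<forall>x\<in>mspace m. \<forall>y\<in>mspace m. mdist m' (f x) (f y) \<le> 1 * mdist m x y"
    using assms by (simp_all add: lipschitz1_def)
  then show "Lipschitz_continuous_map m m' f"
    unfolding Lipschitz_continuous_map_def by blast
qed

lemma lipschitz1_measurable:
  assumes X: "mm_space X" and Y: "sets N = sigma_sets (mspace m) {U. openin (mtopology_of m) U}"
    and f: "f \<in> lipschitz1 (mm_metric X) m"
  shows "f \<in> mm_measure X \<rightarrow>\<^sub>M N"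
proof (rule measurable_sigma_sets[OF Y])
  show "{U. openin (mtopology_of m) U} \<subseteq> Pow (mspace m)"
    by (metis CollectD PowI openin_subset subsetI topspace_mtopology_of)
  show "f \<in> space (mm_measure X) \<rightarrow> mspace m"
    using f by (simp add: space_mm_measure[OF X] lipschitz1_def)
  fix U assume "U \<in> {U. openin (mtopology_of m) U}"
  then have "openin (mm_topology X) {x \<in> mm_carrier X. f x \<in> U}"
    using lipschitz1_continuous[OF f] by (simp add: continuous_map_def)
  moreover have "f -` U \<inter> space (mm_measure X) = {x \<in> mm_carrier X. f x \<in> U}"
    by (auto simp: space_mm_measure[OF X])
  ultimately show "f -` U \<inter> space (mm_measure X) \<in> sets (mm_measure X)"
    by (simp add: sets_mm_measure[OF X] sigma_sets.Basic)
qed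

lemma lipschitz1_measurable_mm:
  assumes "mm_space X" "mm_space Y" "f \<in> lipschitz1 (mm_metric X) (mm_metric Y)"
  shows "f \<in> mm_measure X \<rightarrow>\<^sub>M mm_measure Y"
  by (rule lipschitz1_measurable[OF assms(1) sets_mm_measure[OF assms(2)] assms(3)])

lemma lipschitz1_measurable_real:
  assumes "mm_space X" "f \<in> lipschitz1 (mm_metric X) (euclidean_metric :: real metric)"
  shows "f \<in> mm_measure X \<rightarrow>\<^sub>M borel"
proof (rule lipschitz1_measurable[OF assms(1) _ assms(2)])
  have "sets (borel :: real measure) = sigma_sets UNIV {S. open S}"
    unfolding borel_def by (rule sets_measure_of) simp
  then show "sets (borel :: real measure)
      = sigma_sets (mspace euclidean_metric) {U. openin (mtopology_of (euclidean_metric :: real metric)) U}"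
    by (simp only: mspace_euclidean_metric mtopology_of_euclidean open_openin[symmetric])
qed

lemma lipschitz1_comp:
  assumes f: "f \<in> lipschitz1 m m'" and g: "g \<in> lipschitz1 m' m''"
  shows "g \<circ> f \<in> lipschitz1 m m''"
proof -
  have fin: "f x \<in> mspace m'" if "x \<in> mspace m" for x
    using f that by (auto simp: lipschitz1_def)
  have gin: "g x \<in> mspace m''" if "x \<in> mspace m'" for x
    using g that by (auto simp: lipschitz1_def)
  have "mdist m'' (g (f x)) (g (f y)) \<le> mdist m x y" if "x \<in> mspace m" "y \<in> mspace m" for x y
  proof -
    have "mdist m'' (g (f x)) (g (f y)) \<le> mdist m' (f x) (f y)"
      using g fin that by (simp add: lipschitz1_def)
    also have "\<dots> \<le> mdist m x y"
      using f that by (simp add: lipschitz1_def)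
    finally show ?thesis .
  qed
  then show ?thesis
    using fin gin by (simp add: lipschitz1_def)
qed

lemma mm_isomorphic_refl: "mm_isomorphic X X"
  unfolding mm_isomorphic_def by (rule exI[of _ "\<lambda>x. x"]) (simp add: distr_id)

lemma isometry_lipschitz1:
  assumes "f ` mspace m = mspace m'"
    and "\<forall>x\<in>mspace m. \<forall>y\<in>mspace m. mdist m' (f x) (f y) = mdist m x y"
  shows "f \<in> lipschitz1 m m'"
  using assms by (auto simp: lipschitz1_def)

lemma lip_dominated_trans:
  assumes "mm_space X" "mm_space Y" "mm_space Z" "lip_dominated X Y" "lip_dominated Y Z"
  shows "lip_dominated X Z"
proof -
  obtain f where f: "f \<in> lipschitz1 (mm_metric Z) (mm_metric Y)"
      "distr (mm_measure Z) (mm_measure Y) f = mm_measure Y"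
    using assms by (auto simp: lip_dominated_def)
  obtain g where g: "g \<in> lipschitz1 (mm_metric Y) (mm_metric X)"
      "distr (mm_measure Y) (mm_measure X) g = mm_measure X"
    using assms by (auto simp: lip_dominated_def)
  have "distr (mm_measure Z) (mm_measure X) (g \<circ> f) = mm_measure X"
    using distr_distr[of g "mm_measure Y" "mm_measure X" f "mm_measure Z"] f g assms
      lipschitz1_measurable_mm by metis
  then show ?thesis
    using lipschitz1_comp[OF f(1) g(1)] by (auto simp: lip_dominated_def)
qed

lemma mm_isomorphic_trans:
  assumes X: "mm_space X" and Y: "mm_space Y" and Z: "mm_space Z"
    and XY: "mm_isomorphic X Y" and YZ: "mm_isomorphic Y Z"
  shows "mm_isomorphic X Z"
proof -
  obtain f where f: "f ` mm_carrier X = mm_carrier Y"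
      "\<forall>x\<in>mm_carrier X. \<forall>y\<in>mm_carrier X. mm_dist Y (f x) (f y) = mm_dist X x y"
      "distr (mm_measure X) (mm_measure Y) f = mm_measure Y"
    using XY by (auto simp: mm_isomorphic_def)
  obtain g where g: "g ` mm_carrier Y = mm_carrier Z"
      "\<forall>x\<in>mm_carrier Y. \<forall>y\<in>mm_carrier Y. mm_dist Z (g x) (g y) = mm_dist Y x y"
      "distr (mm_measure Y) (mm_measure Z) g = mm_measure Z"
    using YZ by (auto simp: mm_isomorphic_def)
  have "f \<in> mm_measure X \<rightarrow>\<^sub>M mm_measure Y" "g \<in> mm_measure Y \<rightarrow>\<^sub>M mm_measure Z"
    using f g X Y Z by (auto intro!: lipschitz1_measurable_mm isometry_lipschitz1)
  then have "distr (mm_measure X) (mm_measure Z) (g \<circ> f) = mm_measure Z"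
    using distr_distr[of g "mm_measure Y" "mm_measure Z" f "mm_measure X"] f(3) g(3) by simp
  moreover have "(g \<circ> f) ` mm_carrier X = mm_carrier Z"
    using f(1) g(1) by (metis image_comp)
  moreover have "\<forall>x\<in>mm_carrier X. \<forall>y\<in>mm_carrier X.
      mm_dist Z ((g \<circ> f) x) ((g \<circ> f) y) = mm_dist X x y"
  proof (intro ballI)
    fix x y assume xy: "x \<in> mm_carrier X" "y \<in> mm_carrier X"
    then have "f x \<in> mm_carrier Y" "f y \<in> mm_carrier Y"
      using f(1) by blast+
    then show "mm_dist Z ((g \<circ> f) x) ((g \<circ> f) y) = mm_dist X x y"
      using f(2) g(2) xy by simp
  qed
  ultimately show ?thesis
    unfolding mm_isomorphic_def by blast
qed

lemma mm_isomorphic_sym: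
  assumes X: "mm_space X" and Y: "mm_space Y" and XY: "mm_isomorphic X Y"
  shows "mm_isomorphic Y X"
proof -
  obtain f where f: "f ` mm_carrier X = mm_carrier Y"
      "\<forall>x\<in>mm_carrier X. \<forall>y\<in>mm_carrier X. mm_dist Y (f x) (f y) = mm_dist X x y"
      "distr (mm_measure X) (mm_measure Y) f = mm_measure Y"
    using XY by (auto simp: mm_isomorphic_def)
  have inj: "inj_on f (mm_carrier X)"
    using f(2) by (metis (mono_tags, lifting) inj_onI mdist_zero)
  define g where "g = inv_into (mm_carrier X) f"
  have gf: "g (f x) = x" if "x \<in> mm_carrier X" for x
    using inj that by (simp add: g_def)
  have g1: "g ` mm_carrier Y = mm_carrier X"
    using inj f(1) unfolding g_def by (metis bij_betw_def bij_betw_inv_into)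
  have g2: "\<forall>x\<in>mm_carrier Y. \<forall>y\<in>mm_carrier Y. mm_dist X (g x) (g y) = mm_dist Y x y"
    unfolding f(1)[symmetric] using f(2) gf by simp
  have fm: "f \<in> mm_measure X \<rightarrow>\<^sub>M mm_measure Y"
    using f X Y by (auto intro!: lipschitz1_measurable_mm isometry_lipschitz1)
  have gm: "g \<in> mm_measure Y \<rightarrow>\<^sub>M mm_measure X"
    using g1 g2 X Y by (auto intro!: lipschitz1_measurable_mm isometry_lipschitz1)
  have "distr (mm_measure Y) (mm_measure X) g
      = distr (distr (mm_measure X) (mm_measure Y) f) (mm_measure X) g"
    by (simp add: f(3))
  also have "\<dots> = distr (mm_measure X) (mm_measure X) (g \<circ> f)"
    using fm gm by (simp add: distr_distr)
  also have "\<dots> = distr (mm_measure X) (mm_measure X) (\<lambda>x. x)"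
    by (rule distr_cong) (auto simp: space_mm_measure[OF X] gf)
  also have "\<dots> = mm_measure X"
    by (simp add: distr_id)
  finally show ?thesis
    using g1 g2 unfolding mm_isomorphic_def by blast
qed

lemma mm_isomorphic_dominated: "mm_isomorphic X Y \<Longrightarrow> lip_dominated Y X"
  unfolding mm_isomorphic_def lip_dominated_def by (meson isometry_lipschitz1)

lemma obs_diam_data_mono:
  assumes X: "mm_space X" and Y: "mm_space Y" and d: "lip_dominated Y X"
  shows "obs_diam_data Y \<kappa> \<le> obs_diam_data X \<kappa>"
proof -
  obtain f where f: "f \<in> lipschitz1 (mm_metric X) (mm_metric Y)"
      "distr (mm_measure X) (mm_measure Y) f = mm_measure Y"
    using d by (auto simp: lip_dominated_def)
  show ?thesis
    unfolding obs_diam_data_def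
  proof (rule SUP_least)
    fix g :: "_ \<Rightarrow> real" assume g: "g \<in> lipschitz1 (mm_metric Y) euclidean_metric"
    have "distr (mm_measure Y) borel g = distr (mm_measure X) borel (g \<circ> f)"
      using distr_distr[of g "mm_measure Y" borel f "mm_measure X"] f(2)
        lipschitz1_measurable_mm[OF X Y f(1)] lipschitz1_measurable_real[OF Y g] by simp
    then show "part_diam euclidean_metric (distr (mm_measure Y) borel g) (1 - \<kappa>)
        \<le> (SUP f\<in>lipschitz1 (mm_metric X) (euclidean_metric :: real metric).
             part_diam euclidean_metric (distr (mm_measure X) borel f) (1 - \<kappa>))"
      using lipschitz1_comp[OF f(1) g] by (auto intro: SUP_upper2)
  qed
qed

lemma box_close_sym: "box_close X Y \<epsilon> \<Longrightarrow> box_close Y X \<epsilon>"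
  unfolding box_close_def by (metis (no_types, lifting) abs_minus_commute)

lemma box_dist_data_sym: "box_dist_data X Y = box_dist_data Y X"
proof -
  have "box_close X Y = box_close Y X"
    by (auto intro: box_close_sym)
  then show ?thesis
    by (simp add: box_dist_data_def)
qed

lemma box_dist_data_iso_le:
  assumes X: "mm_space X" and Y: "mm_space Y" and XY: "mm_isomorphic X Y"
  shows "box_dist_data Y Z \<le> box_dist_data X Z"
proof -
  obtain f where f: "f ` mm_carrier X = mm_carrier Y"
      "\<forall>x\<in>mm_carrier X. \<forall>y\<in>mm_carrier X. mm_dist Y (f x) (f y) = mm_dist X x y"
      "distr (mm_measure X) (mm_measure Y) f = mm_measure Y"
    using XY by (auto simp: mm_isomorphic_def)
  have fm: "f \<in> mm_measure X \<rightarrow>\<^sub>M mm_measure Y"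
    using f X Y by (auto intro!: lipschitz1_measurable_mm isometry_lipschitz1)
  have par: "mm_parameter Y (f \<circ> \<phi>)" if "mm_parameter X \<phi>" for \<phi>
    using that fm f(3) distr_distr[of f "mm_measure X" "mm_measure Y" \<phi> lborel_01]
    by (auto simp: mm_parameter_def)
  have car: "\<phi> s \<in> mm_carrier X" if "mm_parameter X \<phi>" "s \<in> {0..1}" for \<phi> s
    using that measurable_space[of \<phi> lborel_01 "mm_measure X" s]
    by (auto simp: mm_parameter_def space_mm_measure[OF X] space_restrict_space)
  have "box_close Y Z \<epsilon>" if "box_close X Z \<epsilon>" for \<epsilon>
  proof -
    obtain \<phi> \<psi> I where p: "mm_parameter X \<phi>" "mm_parameter Z \<psi>"
      and I: "I \<in> sets borel" "I \<subseteq> {0..1}" "1 - \<epsilon> \<le> measure lborel I"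
      and d: "\<forall>s\<in>I. \<forall>t\<in>I. \<bar>mm_dist X (\<phi> s) (\<phi> t) - mm_dist Z (\<psi> s) (\<psi> t)\<bar> \<le> \<epsilon>"
      using \<open>box_close X Z \<epsilon>\<close> unfolding box_close_def by blast
    have "\<phi> s \<in> mm_carrier X" if "s \<in> I" for s
      using car[OF p(1)] I(2) that by (meson subsetD)
    then have "\<forall>s\<in>I. \<forall>t\<in>I. \<bar>mm_dist Y ((f \<circ> \<phi>) s) ((f \<circ> \<phi>) t) - mm_dist Z (\<psi> s) (\<psi> t)\<bar> \<le> \<epsilon>"
      using d f(2) by simp
    then show ?thesis
      unfolding box_close_def using par[OF p(1)] p(2) I by blast
  qed
  then show ?thesis
    unfolding box_dist_data_def by (intro INF_superset_mono) auto
qed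


section \<open>Isomorphism classes\<close>

text \<open>A separable metric space has at most the cardinality of the continuum, so every mm-space, over
  whatever type, is mm-isomorphic to one whose underlying set is a set of real numbers (with a metric
  that in general has nothing to do with the distance on the real line). Classes of the latter
  therefore represent all mm-spaces.\<close>

lemma mm_space_real_model:
  fixes X :: "'a mm_data"
  assumes X: "mm_space X"
  shows "\<exists>Y :: real mm_data. mm_space Y \<and> mm_isomorphic X Y"
proof -
  let ?M = "mm_carrier X" and ?d = "mm_dist X"
  interpret M: Metric_space ?M ?d
    by simp
  have T: "mm_topology X = M.mtopology"
    by (simp add: mtopology_of_def)
  obtain C where C: "countable C" "C \<subseteq> ?M" "M.mtopology closure_of C = ?M"
    using X unfolding mm_space_def separable_space_def T by auto
  define E where "E x = (\<lambda>(c, n). prod_encode (to_nat_on C c, n)) `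
      {(c, n :: nat). c \<in> C \<and> ?d x c < 1 / Suc n}" for x
  have mem: "prod_encode (to_nat_on C c, n) \<in> E x \<longleftrightarrow> ?d x c < 1 / Suc n" if "c \<in> C" for c n x
    using that inj_on_to_nat_on[OF C(1)] unfolding E_def
    by (auto simp: image_iff prod_encode_eq dest: inj_onD)
  have "inj_on E ?M"
  proof (rule inj_onI)
    fix x y assume x: "x \<in> ?M" and y: "y \<in> ?M" and eq: "E x = E y"
    show "x = y"
    proof (rule ccontr)
      assume "x \<noteq> y"
      then have "0 < ?d x y / 2"
        using x y by simp
      then obtain n where n: "1 / Suc n < ?d x y / 2"
        using reals_Archimedean by (metis inverse_eq_divide)
      have "x \<in> M.mtopology closure_of C"
        using x C by simp
      moreover have "0 < 1 / real (Suc n)"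
        by simp
      ultimately have "\<exists>c\<in>C. c \<in> M.mball x (1 / real (Suc n))"
        unfolding M.metric_closure_of by blast
      then obtain c where c: "c \<in> C" "?d x c < 1 / Suc n"
        unfolding M.in_mball by (elim bexE conjE)
      then have "?d y c < 1 / Suc n"
        using mem[OF c(1)] eq by blast
      moreover have "?d x y \<le> ?d x c + ?d y c"
        using M.triangle'[OF x _ y] c C(2) M.commute by (metis subsetD)
      ultimately show False
        using c n by linarith
    qed
  qed
  moreover obtain h :: "nat set \<Rightarrow> real" where "bij h"
    using nat_sets_eqpoll_reals unfolding eqpoll_def by blast
  ultimately have "inj_on (h \<circ> E) ?M"
    by (intro comp_inj_on) (auto dest: bij_is_inj intro: inj_on_subset)
  then obtain g :: "'a \<Rightarrow> real" where g: "inj_on g ?M"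
    by blast
  define N where "N = g ` ?M"
  define k where "k = inv_into ?M g"
  have kg: "k (g x) = x" if "x \<in> ?M" for x
    using g that by (simp add: k_def)
  have kN: "k y \<in> ?M" "g (k y) = y" if "y \<in> N" for y
    using that kg by (auto simp: N_def)
  interpret N: Metric_space N "\<lambda>x y. ?d (k x) (k y)"
  proof
    show "?d (k x) (k y) = 0 \<longleftrightarrow> x = y" if "x \<in> N" "y \<in> N" for x y
      using kN that by (metis M.zero)
  qed (auto simp: M.commute kN intro: M.triangle)
  define m where "m = metric (N, \<lambda>x y. ?d (k x) (k y))"
  have m: "mspace m = N" "mdist m = (\<lambda>x y. ?d (k x) (k y))" "mtopology_of m = N.mtopology"
    "mcomplete_of m \<longleftrightarrow> N.mcomplete"
    by (simp_all add: m_def)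
  have iso: "g ` ?M = mspace m" "\<forall>x\<in>?M. \<forall>y\<in>?M. mdist m (g x) (g y) = ?d x y"
    by (auto simp: m N_def kg)
  interpret MN: Metric_space12 ?M ?d N "\<lambda>x y. ?d (k x) (k y)"
    by (simp add: Metric_space12_def M.Metric_space_axioms N.Metric_space_axioms)
  have hom: "homeomorphic_map M.mtopology N.mtopology g"
    using MN.isometry_imp_homeomorphic_map[of g] iso by (simp add: m)
  have gc: "continuous_map M.mtopology N.mtopology g"
    using hom homeomorphic_imp_continuous_map by blast
  define \<nu> where "\<nu> = distr (mm_measure X) (borel_of (mtopology_of m)) g"
  define Y where "Y = MM m \<nu>"
  have sub: "{U. openin (mtopology_of m) U} \<subseteq> Pow (mspace m)"
    by (metis CollectD PowI openin_subset subsetI topspace_mtopology_of)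
  have sets_b: "sets (borel_of (mtopology_of m)) = sigma_sets (mspace m) {U. openin (mtopology_of m) U}"
    using sub by (simp add: borel_of_def sets_measure_of)
  have gm: "g \<in> mm_measure X \<rightarrow>\<^sub>M borel_of (mtopology_of m)"
    by (rule lipschitz1_measurable[OF X sets_b isometry_lipschitz1[OF iso]])
  have complete: "N.mcomplete"
    unfolding N.mcomplete_def
  proof (intro allI impI)
    fix \<sigma> assume s: "N.MCauchy \<sigma>"
    then have "range \<sigma> \<subseteq> N"
      by (simp add: N.MCauchy_def)
    then have cau: "M.MCauchy (k \<circ> \<sigma>)"
      using s kN unfolding M.MCauchy_def N.MCauchy_def by auto
    have "M.mcomplete"
      using X by (simp add: mm_space_def mcomplete_of_def)
    then obtain x where "limitin M.mtopology (k \<circ> \<sigma>) x sequentially"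
      using cau unfolding M.mcomplete_def by meson
    then have "limitin N.mtopology (g \<circ> (k \<circ> \<sigma>)) (g x) sequentially"
      by (rule continuous_map_limit[OF gc])
    moreover have "g \<circ> (k \<circ> \<sigma>) = \<sigma>"
      using \<open>range \<sigma> \<subseteq> N\<close> kN by (auto simp: fun_eq_iff)
    ultimately show "\<exists>x. limitin N.mtopology \<sigma> x sequentially"
      by auto
  qed
  have sep: "separable_space N.mtopology"
    using X homeomorphic_separable_space[OF homeomorphic_map_imp_homeomorphic_space[OF hom]]
    by (simp add: mm_space_def T)
  have full: "0 < emeasure \<nu> U" if U: "openin N.mtopology U" "U \<noteq> {}" for U
  proof -
    have "U \<in> sets (borel_of (mtopology_of m))"
      using U unfolding sets_b by (simp add: m sigma_sets.Basic)
    then have "emeasure \<nu> U = emeasure (mm_measure X) (g -` U \<inter> space (mm_measure X))"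
      unfolding \<nu>_def by (rule emeasure_distr[OF gm])
    also have "g -` U \<inter> space (mm_measure X) = {x \<in> ?M. g x \<in> U}"
      by (auto simp: space_mm_measure[OF X])
    finally have "emeasure \<nu> U = emeasure (mm_measure X) {x \<in> ?M. g x \<in> U}" .
    moreover have "openin M.mtopology {x \<in> ?M. g x \<in> U}"
      using gc U by (simp add: continuous_map_def)
    moreover have "{x \<in> ?M. g x \<in> U} \<noteq> {}"
    proof -
      have "U \<subseteq> N"
        using openin_subset[OF U(1)] by simp
      then show ?thesis
        using U(2) unfolding N_def by blast
    qed
    ultimately show ?thesis
      using X by (simp add: mm_space_def T)
  qed
  have "prob_space \<nu>"
    using X gm unfolding \<nu>_def mm_space_def by (simp add: prob_space.prob_space_distr)
  then have "mm_space Y"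
    using complete sep full by (simp add: mm_space_def Y_def m) (simp add: \<nu>_def m)
  moreover have "distr (mm_measure X) \<nu> g = \<nu>"
    unfolding \<nu>_def by (rule distr_cong) auto
  then have "mm_isomorphic X Y"
    using iso unfolding mm_isomorphic_def by (auto simp: Y_def)
  ultimately show ?thesis
    by blast
qed

definition mm_equiv :: "real mm_data \<Rightarrow> real mm_data \<Rightarrow> bool" where
  "mm_equiv X Y \<longleftrightarrow> mm_space X \<and> mm_space Y \<and> mm_isomorphic X Y"

lemma mm_space_exists: "\<exists>X :: real mm_data. mm_space X"
proof -
  interpret Metric_space "{0::real}" dist
    by (rule Met_TC.subspace) simp
  define m where "m = metric ({0::real}, dist)"
  define X where "X = MM m (return (borel_of (mtopology_of m)) 0)"
  have comp: "mcomplete"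
    unfolding mcomplete_def
  proof (intro allI impI)
    fix \<sigma> assume "MCauchy \<sigma>"
    then have "range \<sigma> \<subseteq> {0}"
      unfolding MCauchy_def by (rule conjunct1)
    then have "\<sigma> n = 0" for n
      by blast
    then have "limitin mtopology \<sigma> 0 sequentially"
      by (simp add: limit_metric_sequentially)
    then show "\<exists>x. limitin mtopology \<sigma> x sequentially"
      by (rule exI)
  qed
  have sep: "separable_space mtopology"
    unfolding separable_space_def by (intro exI[of _ "{0}"]) (metis closure_of_topspace countable_finite
        finite.emptyI finite_insert order_refl topspace_mtopology)
  have sub: "{U. openin mtopology U} \<subseteq> Pow {0}"
    by (metis CollectD PowI openin_subset subsetI topspace_mtopology)
  have sp: "space (borel_of mtopology) = {0}"
    using sub by (simp add: borel_of_def space_measure_of)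
  have op: "U \<in> sets (borel_of mtopology)" if "openin mtopology U" for U
    using sub that by (simp add: borel_of_def sets_measure_of sigma_sets.Basic)
  have "mm_space X"
    unfolding mm_space_def
  proof (intro conjI allI impI)
    show "prob_space (mm_measure X)"
      by (simp add: X_def m_def prob_space_return sp)
    fix U assume U: "openin (mm_topology X) U \<and> U \<noteq> {}"
    then have "openin mtopology U"
      by (simp add: X_def m_def)
    moreover from this U have "0 \<in> U"
      using sub by blast
    ultimately show "0 < emeasure (mm_measure X) U"
      using op by (simp add: X_def m_def)
  qed (use comp sep in \<open>simp_all add: X_def m_def\<close>)
  then show ?thesis
    by blast
qed

lemma mm_equivD:
  assumes "mm_equiv X Y"
  shows "mm_space X" "mm_space Y" "mm_isomorphic X Y" "mm_isomorphic Y X"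
    "lip_dominated X Y" "lip_dominated Y X"
  using assms mm_isomorphic_sym[of X Y] mm_isomorphic_dominated[of X Y] mm_isomorphic_dominated[of Y X]
  by (simp_all add: mm_equiv_def)

quotient_type mm_class = "real mm_data" / partial: mm_equiv
proof (rule part_equivpI)
  show "\<exists>X. mm_equiv X X"
    using mm_space_exists mm_isomorphic_refl by (auto simp: mm_equiv_def)
  show "symp mm_equiv"
    by (rule sympI) (simp add: mm_equiv_def mm_isomorphic_sym)
  show "transp mm_equiv"
  proof (rule transpI)
    fix X Y Z assume XY: "mm_equiv X Y" and YZ: "mm_equiv Y Z"
    note xy = XY[unfolded mm_equiv_def] and yz = YZ[unfolded mm_equiv_def]
    have "mm_isomorphic X Z"
      by (rule mm_isomorphic_trans[of X Y Z]) (simp_all add: xy yz)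
    then show "mm_equiv X Z"
      by (simp add: mm_equiv_def xy yz)
  qed
qed

lift_definition dominated :: "mm_class \<Rightarrow> mm_class \<Rightarrow> bool" (infix "\<prec>\<^sub>L" 50)
  is lip_dominated
proof -
  fix X X' Y Y' :: "real mm_data"
  assume X: "mm_equiv X X'" and Y: "mm_equiv Y Y'"
  note x = mm_equivD[OF X] and y = mm_equivD[OF Y]
  show "lip_dominated X Y = lip_dominated X' Y'"
  proof
    assume "lip_dominated X Y"
    then have "lip_dominated X' Y"
      using lip_dominated_trans[OF x(2) x(1) y(1) x(6)] by simp
    then show "lip_dominated X' Y'"
      using lip_dominated_trans[OF x(2) y(1) y(2) _ y(5)] by simp
  next
    assume "lip_dominated X' Y'"
    then have "lip_dominated X Y'"
      using lip_dominated_trans[OF x(1) x(2) y(2) x(5)] by simp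
    then show "lip_dominated X Y"
      using lip_dominated_trans[OF x(1) y(2) y(1) _ y(6)] by simp
  qed
qed

lift_definition box_dist :: "mm_class \<Rightarrow> mm_class \<Rightarrow> ennreal"
  is box_dist_data
proof -
  fix X X' Y Y' :: "real mm_data"
  assume X: "mm_equiv X X'" and Y: "mm_equiv Y Y'"
  have *: "box_dist_data A Z = box_dist_data B Z" if "mm_equiv A B" for A B Z :: "real mm_data"
    using mm_equivD[OF that] by (intro antisym box_dist_data_iso_le)
  have "box_dist_data X Y = box_dist_data X' Y"
    by (rule *[OF X])
  also have "\<dots> = box_dist_data Y X'"
    by (rule box_dist_data_sym)
  also have "\<dots> = box_dist_data Y' X'"
    by (rule *[OF Y])
  also have "\<dots> = box_dist_data X' Y'"
    by (rule box_dist_data_sym)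
  finally show "box_dist_data X Y = box_dist_data X' Y'" .
qed

lift_definition obs_diam :: "mm_class \<Rightarrow> real \<Rightarrow> ennreal"
  is obs_diam_data
proof -
  fix X X' :: "real mm_data"
  assume "mm_equiv X X'"
  note x = mm_equivD[OF this]
  show "obs_diam_data X = obs_diam_data X'"
    using x by (intro ext antisym obs_diam_data_mono)
qed


section \<open>Pyramids\<close>

definition box_dist_set :: "mm_class \<Rightarrow> mm_class set \<Rightarrow> ennreal" where
  "box_dist_set X P = (INF Y\<in>P. box_dist X Y)"

definition box_closed :: "mm_class set \<Rightarrow> bool" where
  "box_closed P \<longleftrightarrow> (\<forall>X. (\<forall>\<epsilon>>0. \<exists>Y\<in>P. box_dist X Y < \<epsilon>) \<longrightarrow> X \<in> P)"

definition pyramid :: "mm_class set \<Rightarrow> bool" where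
  "pyramid P \<longleftrightarrow>
     P \<noteq> {} \<and> box_closed P \<and>
     (\<forall>X Y. Y \<in> P \<and> X \<prec>\<^sub>L Y \<longrightarrow> X \<in> P) \<and>
     (\<forall>X\<in>P. \<forall>Y\<in>P. \<exists>Z\<in>P. X \<prec>\<^sub>L Z \<and> Y \<prec>\<^sub>L Z)"

definition weakly_converges :: "(nat \<Rightarrow> mm_class set) \<Rightarrow> mm_class set \<Rightarrow> bool" where
  "weakly_converges P Q \<longleftrightarrow>
     (\<forall>X\<in>Q. (\<lambda>n. box_dist_set X (P n)) \<longlonglongrightarrow> 0) \<and>
     (\<forall>X. X \<notin> Q \<longrightarrow> 0 < liminf (\<lambda>n. box_dist_set X (P n)))"

definition pyramid_obs_diam :: "mm_class set \<Rightarrow> real \<Rightarrow> ennreal" where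
  "pyramid_obs_diam P \<kappa> = (SUP X\<in>P. obs_diam X \<kappa>)"

end

theory Submission
  imports Defs "HOL-Real_Asymp.Real_Asymp"
begin

text \<open>Two inequalities give the limit formula, one for each half of the definition of weak convergence. Both
rest on the fact that the observable diameter moves little under a small change in box distance: if
\<open>box_dist X Y < \<delta>\<close>, then \<open>obs_diam X (\<kappa> + \<delta>) \<le> obs_diam Y \<kappa> + \<delta>\<close>
(\<open>obs_diam_box_dist\<close>). Indeed, two parameters that nearly match the distances carry a 1-Lipschitz
function on \<open>X\<close> to one on \<open>Y\<close>, by the McShane extension, with values that differ by at most
\<open>\<delta>\<close> off a set of measure \<open>\<delta>\<close>.

Lower bound. A space \<open>X\<close> in the limit pyramid is the box limit of spaces in the given pyramids, so by
the stability just stated \<open>obs_diam X (\<kappa> + \<epsilon>\<^sub>0)\<close> is, up to an arbitrarily small error, eventually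
a lower bound for the observable diameters of these pyramids at \<open>\<kappa> + \<epsilon>\<close> whenever \<open>\<epsilon> < \<epsilon>\<^sub>0\<close>. It remains to
let \<open>\<epsilon>\<^sub>0\<close> tend to zero, which is harmless because the observable diameter is continuous from the
right in \<open>\<kappa>\<close> (\<open>obs_diam_right_continuous\<close>): on the line only intervals matter for the partial
diameter, and intervals of bounded length that carry a fixed amount of mass form a compact family.

Upper bound. Let \<open>c\<close> exceed the observable diameter of the limit pyramid at \<open>\<kappa>\<close>, and suppose that
infinitely many of the pyramids contain a space with a 1-Lipschitz function
whose law on the line has partial diameter above \<open>c\<close> at level \<open>1 - (\<kappa> + \<epsilon>)\<close>. The line with such
a law is dominated by the space, hence lies in the pyramid, but a sequence of such laws need not be tight: mass can
escape at different speeds. This is repaired by a further 1-Lipschitz map (\<open>bounded_contraction\<close>) that shortens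
the long gaps which carry little mass. It compresses the line into an interval whose length depends
only on \<open>c\<close> and \<open>\<epsilon>\<close>, and at the expense of \<open>\<epsilon> / 2\<close> in the level it keeps the partial
diameter at least \<open>c\<close>. Helly's theorem now gives a weakly convergent subsequence of the laws, and their quantile functions
are parameters that converge almost everywhere, so the spaces converge in box distance
(\<open>bounded_laws_box_convergent_subsequence\<close>). The limit space belongs to the limit pyramid by the second
half of weak convergence, and by stability its observable diameter at \<open>\<kappa>\<close> is at least
\<open>c\<close>, a contradiction.\<close>

section \<open>Partial diameter on the line\<close>

lemma ediam_le_iff:
  assumes "0 \<le> d"
  shows "ediam m A \<le> ennreal d \<longleftrightarrow> (\<forall>x\<in>A. \<forall>y\<in>A. mdist m x y \<le> d)"
  using assms by (simp add: ediam_def SUP_le_iff)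

lemma part_diam_nonpos:
  assumes "\<alpha> \<le> 0"
  shows "part_diam m \<nu> \<alpha> = 0"
proof -
  have "part_diam m \<nu> \<alpha> \<le> ediam m {}"
    unfolding part_diam_def using assms by (intro INF_lower) simp
  then show ?thesis
    by (simp add: ediam_def bot_ennreal)
qed

lemma part_diam_antimono:
  assumes "\<alpha> \<le> \<beta>"
  shows "part_diam m \<nu> \<alpha> \<le> part_diam m \<nu> \<beta>"
  unfolding part_diam_def using assms by (intro INF_superset_mono) auto

text \<open>A set of diameter \<open>d\<close> on the line lies in an interval of length \<open>d\<close>, so intervals suffice to
compute partial diameters. This and the next lemma are the form in which partial diameters are used
from here on.\<close>

lemma part_diam_le_interval:
  fixes \<nu> :: "real measure"
  assumes "sets \<nu> = sets borel" "0 \<le> d" "\<alpha> \<le> measure \<nu> {u..u + d}"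
  shows "part_diam euclidean_metric \<nu> \<alpha> \<le> ennreal d"
proof -
  have "part_diam euclidean_metric \<nu> \<alpha> \<le> ediam euclidean_metric {u..u + d}"
    unfolding part_diam_def using assms by (intro INF_lower) simp
  also have "\<dots> \<le> ennreal d"
    using assms(2) by (subst ediam_le_iff) (auto simp: dist_real_def)
  finally show ?thesis .
qed

lemma interval_if_part_diam_less:
  fixes \<nu> :: "real measure"
  assumes "finite_measure \<nu>" "sets \<nu> = sets borel" "0 < \<alpha>"
    and less: "part_diam euclidean_metric \<nu> \<alpha> < ennreal d"
  shows "\<exists>u. \<alpha> \<le> measure \<nu> {u..u + d}"
proof -
  interpret finite_measure \<nu> by fact
  obtain A where A: "A \<in> sets \<nu>" "\<alpha> \<le> measure \<nu> A" "ediam euclidean_metric A < ennreal d"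
    using less unfolding part_diam_def INF_less_iff by blast
  have d: "0 \<le> d"
    using A(3) by (metis ennreal_neg not_less_zero linorder_linear)
  have diam: "\<bar>x - y\<bar> \<le> d" if "x \<in> A" "y \<in> A" for x y
    using less_imp_le[OF A(3)] that by (simp add: ediam_le_iff[OF d] dist_real_def)
  have ne: "A \<noteq> {}"
    using A(2) assms(3) by auto
  then obtain a where a: "a \<in> A"
    by blast
  have bdd: "bdd_below A"
    using diam[OF a] by (intro bdd_belowI[of _ "a - d"]) (smt (verit))
  have "A \<subseteq> {Inf A..Inf A + d}"
  proof
    fix x assume x: "x \<in> A"
    have "x - d \<le> Inf A"
      using ne diam[OF x] by (intro cInf_greatest) (auto simp: abs_le_iff, smt (verit))
    then show "x \<in> {Inf A..Inf A + d}"
      using cInf_lower[OF x bdd] by simp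
  qed
  then have "measure \<nu> A \<le> measure \<nu> {Inf A..Inf A + d}"
    using assms(2) by (intro finite_measure_mono) auto
  then show ?thesis
    using A(2) by (intro exI[of _ "Inf A"]) linarith
qed

lemma (in real_distribution) mass_centered_interval:
  assumes "\<beta> < 1"
  shows "\<exists>R>0. \<beta> < measure M {-R..R}"
proof -
  have "(\<lambda>n. measure M {-real n..real n}) \<longlonglongrightarrow> measure M (\<Union>n. {-real n..real n})"
    by (intro finite_Lim_measure_incseq) (auto simp: incseq_def)
  moreover have "(\<Union>n. {-real n..real n}) = UNIV"
  proof (intro equalityI subsetI UNIV_I)
    fix x :: real
    obtain n where "\<bar>x\<bar> \<le> real n"
      using real_arch_simple by blast
    then show "x \<in> (\<Union>n. {-real n..real n})"
      by (intro UN_I[of n]) (auto simp: abs_le_iff)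
  qed
  ultimately have "(\<lambda>n. measure M {-real n..real n}) \<longlonglongrightarrow> 1"
    using prob_space by simp
  then have "eventually (\<lambda>n. \<beta> < measure M {-real n..real n}) sequentially"
    using assms by (rule order_tendstoD)
  then obtain n where "\<beta> < measure M {-real n..real n}"
    using eventually_happens'[OF sequentially_bot] by blast
  moreover have "measure M {-real n..real n} \<le> measure M {-(real n + 1)..real n + 1}"
    by (intro finite_measure_mono) auto
  ultimately show ?thesis
    by (intro exI[of _ "real n + 1"]) auto
qed

text \<open>Intervals of length \<open>d\<close> with mass at least \<open>\<alpha> - \<epsilon>\<close>, where \<open>\<epsilon> \<le> \<alpha> / 2\<close>, all meet one fixed bounded interval, as
the masses would otherwise add up to more than one. Hence their endpoints accumulate when \<open>\<epsilon>\<close>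
tends to zero, and a slightly longer interval at a limit point has mass at least \<open>\<alpha>\<close>.\<close>

lemma (in real_distribution) part_diam_left_continuous:
  assumes D: "0 \<le> D" and le: "\<And>\<epsilon>. 0 < \<epsilon> \<Longrightarrow> part_diam euclidean_metric M (\<alpha> - \<epsilon>) \<le> ennreal D"
  shows "part_diam euclidean_metric M \<alpha> \<le> ennreal D"
proof (cases "0 < \<alpha>")
  case False
  then show ?thesis
    by (simp add: part_diam_nonpos)
next
  case True
  show ?thesis
  proof (rule ennreal_le_epsilon)
    fix e :: real assume e: "0 < e"
    \<comment> \<open>One third of \<open>e\<close> covers the strict inequality, the others the convergence of the endpoints.\<close>
    define d where "d = D + e / 3"
    define \<epsilon> where "\<epsilon> n = \<alpha> / (real n + 2)" for n
    have \<epsilon>: "0 < \<epsilon> n" "\<epsilon> n \<le> \<alpha> / 2" for n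
      using True by (auto simp: \<epsilon>_def field_simps)
    have "\<exists>u. \<alpha> - \<epsilon> n \<le> measure M {u..u + d}" for n
    proof (rule interval_if_part_diam_less)
      have "part_diam euclidean_metric M (\<alpha> - \<epsilon> n) \<le> ennreal D"
        using le \<epsilon> by blast
      also have "\<dots> < ennreal d"
        using D e by (simp add: d_def ennreal_less_iff)
      finally show "part_diam euclidean_metric M (\<alpha> - \<epsilon> n) < ennreal d" .
      show "0 < \<alpha> - \<epsilon> n"
        using \<epsilon>(2)[of n] True by linarith
    qed (auto intro: finite_measure_axioms)
    then obtain u where u: "\<And>n. \<alpha> - \<epsilon> n \<le> measure M {u n..u n + d}"
      by metis
    obtain R where R: "1 - \<alpha> / 2 < measure M {-R..R}"
      using mass_centered_interval[of "1 - \<alpha> / 2"] True by auto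
    have "u n \<in> {-R - d..R}" for n
    proof (rule ccontr)
      assume "u n \<notin> {-R - d..R}"
      then have "measure M ({u n..u n + d} \<union> {-R..R}) = measure M {u n..u n + d} + measure M {-R..R}"
        by (intro finite_measure_Union) auto
      moreover have "measure M ({u n..u n + d} \<union> {-R..R}) \<le> 1"
        by (rule prob_le_1)
      ultimately show False
        using u[of n] R \<epsilon>(2)[of n] by linarith
    qed
    then obtain a r where r: "strict_mono r" "(u \<circ> r) \<longlonglongrightarrow> a"
      using compact_imp_seq_compact[OF compact_Icc[of "-R - d" R]] unfolding seq_compact_def by metis
    have "\<alpha> \<le> measure M {a - e / 3..a - e / 3 + (D + e)}"
    proof (rule tendsto_upperbound)
      have "(\<lambda>n. \<alpha> - \<epsilon> n) \<longlonglongrightarrow> \<alpha> - 0"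
        unfolding \<epsilon>_def by (intro tendsto_intros) real_asymp
      then show "((\<lambda>n. \<alpha> - \<epsilon> n) \<circ> r) \<longlonglongrightarrow> \<alpha>"
        using LIMSEQ_subseq_LIMSEQ r(1) by fastforce
      have "eventually (\<lambda>n. dist ((u \<circ> r) n) a < e / 3) sequentially"
        using e by (intro tendstoD[OF r(2)]) simp
      then show "eventually (\<lambda>n. ((\<lambda>n. \<alpha> - \<epsilon> n) \<circ> r) n
          \<le> measure M {a - e / 3..a - e / 3 + (D + e)}) sequentially"
      proof eventually_elim
        case (elim n)
        have "measure M {u (r n)..u (r n) + d} \<le> measure M {a - e / 3..a - e / 3 + (D + e)}"
        proof (rule finite_measure_mono)
          have "\<bar>u (r n) - a\<bar> < e / 3"
            using elim by (simp only: dist_real_def comp_apply)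
          then have "a - e / 3 \<le> u (r n)" "u (r n) + d \<le> a - e / 3 + (D + e)"
            unfolding d_def by linarith+
          then show "{u (r n)..u (r n) + d} \<subseteq> {a - e / 3..a - e / 3 + (D + e)}"
            by auto
        qed simp
        then show ?case
          using u[of "r n"] by simp
      qed
    qed simp
    then have "part_diam euclidean_metric M \<alpha> \<le> ennreal (D + e)"
      using D e by (intro part_diam_le_interval[where u = "a - e / 3"]) simp_all
    then show "part_diam euclidean_metric M \<alpha> \<le> ennreal D + ennreal e"
      using D e by simp
  qed
qed

section \<open>Stability of the observable diameter in the box distance\<close>

lemma obs_diam_data_antimono:
  assumes "\<kappa> \<le> \<kappa>'"
  shows "obs_diam_data X \<kappa>' \<le> obs_diam_data X \<kappa>"
  unfolding obs_diam_data_def using assms by (intro SUP_mono' part_diam_antimono) simp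

lemma lipschitz1_real_iff:
  "f \<in> lipschitz1 m (euclidean_metric :: real metric) \<longleftrightarrow>
     (\<forall>x\<in>mspace m. \<forall>y\<in>mspace m. \<bar>f x - f y\<bar> \<le> mdist m x y)"
  by (simp add: lipschitz1_def dist_real_def)

lemma mm_parameter_in_carrier:
  assumes "mm_space X" "mm_parameter X \<phi>" "s \<in> {0..1}"
  shows "\<phi> s \<in> mm_carrier X"
  using assms measurable_space[of \<phi> lborel_01 "mm_measure X" s]
  by (auto simp: mm_parameter_def space_mm_measure space_restrict_space)

lemma measure_distr_parameter:
  assumes X: "mm_space X" and p: "mm_parameter X \<phi>"
    and f: "f \<in> lipschitz1 (mm_metric X) (euclidean_metric :: real metric)"
    and A: "A \<in> sets borel"
  shows "measure (distr (mm_measure X) borel f) A = measure lborel {s \<in> {0..1}. f (\<phi> s) \<in> A}"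
    and "{s \<in> {0..1}. f (\<phi> s) \<in> A} \<in> sets borel"
proof -
  have fm: "f \<in> mm_measure X \<rightarrow>\<^sub>M borel"
    by (rule lipschitz1_measurable_real[OF X f])
  have pm: "\<phi> \<in> lborel_01 \<rightarrow>\<^sub>M mm_measure X"
    and pd: "distr lborel_01 (mm_measure X) \<phi> = mm_measure X"
    using p by (auto simp: mm_parameter_def)
  have cm: "f \<circ> \<phi> \<in> lborel_01 \<rightarrow>\<^sub>M borel"
    using fm pm by simp
  have eq: "(f \<circ> \<phi>) -` A \<inter> space lborel_01 = {s \<in> {0..1}. f (\<phi> s) \<in> A}"
    by (auto simp: space_restrict_space)
  have S: "(f \<circ> \<phi>) -` A \<inter> space lborel_01 \<in> sets lborel_01"
    using cm A by (rule measurable_sets)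
  then show "{s \<in> {0..1}. f (\<phi> s) \<in> A} \<in> sets borel"
    unfolding eq by (subst (asm) sets_restrict_space_iff) auto
  have "distr (mm_measure X) borel f = distr (distr lborel_01 (mm_measure X) \<phi>) borel f"
    by (simp add: pd)
  also have "\<dots> = distr lborel_01 borel (f \<circ> \<phi>)"
    by (rule distr_distr[OF fm pm])
  finally have "measure (distr (mm_measure X) borel f) A
      = measure lborel_01 {s \<in> {0..1}. f (\<phi> s) \<in> A}"
    by (simp only: measure_distr[OF cm A] eq)
  also have "\<dots> = measure lborel {s \<in> {0..1}. f (\<phi> s) \<in> A}"
    by (rule measure_restrict_space) auto
  finally show "measure (distr (mm_measure X) borel f) A = measure lborel {s \<in> {0..1}. f (\<phi> s) \<in> A}" .
qed

lemma real_distribution_distr_lipschitz1: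
  assumes X: "mm_space X" and f: "f \<in> lipschitz1 (mm_metric X) (euclidean_metric :: real metric)"
  shows "real_distribution (distr (mm_measure X) borel f)"
  using X lipschitz1_measurable_real[OF X f]
  by (simp add: mm_space_def prob_space.real_distribution_distr)

text \<open>On the set \<open>I\<close> where the distances agree up to \<open>\<delta>\<close>, the function \<open>f\<close> along the parameter of \<open>X\<close>
is 1-Lipschitz up to \<open>\<delta>\<close> for the distance of \<open>Y\<close>. Its McShane extension \<open>g\<close> to \<open>Y\<close> is exactly
1-Lipschitz and, at corresponding points of the parameters, lies below \<open>f\<close> by at most \<open>\<delta>\<close>. An interval for the law of \<open>g\<close>
thus becomes one for the law of \<open>f\<close> after it is lengthened by \<open>\<delta>\<close>, with a loss of mass of at most
\<open>\<delta>\<close> for the complement of \<open>I\<close>.\<close>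

lemma obs_diam_data_box_close:
  fixes X :: "'a mm_data" and Y :: "'b mm_data"
  assumes X: "mm_space X" and Y: "mm_space Y" and close: "box_close X Y \<delta>"
    and \<delta>: "0 \<le> \<delta>" and \<kappa>: "0 \<le> \<kappa>"
  shows "obs_diam_data X (\<kappa> + \<delta>) \<le> obs_diam_data Y \<kappa> + ennreal \<delta>"
proof -
  obtain \<phi> \<psi> I where p: "mm_parameter X \<phi>" "mm_parameter Y \<psi>"
    and I: "I \<in> sets borel" "I \<subseteq> {0..1}" "1 - \<delta> \<le> measure lborel I"
    and d: "\<And>s t. s \<in> I \<Longrightarrow> t \<in> I \<Longrightarrow> \<bar>mm_dist X (\<phi> s) (\<phi> t) - mm_dist Y (\<psi> s) (\<psi> t)\<bar> \<le> \<delta>"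
    using close unfolding box_close_def by blast
  show ?thesis
  proof (cases "1 - (\<kappa> + \<delta>) \<le> 0")
    case True
    then show ?thesis
      unfolding obs_diam_data_def[of X] by (intro SUP_least) (simp add: part_diam_nonpos)
  next
    case False
    then have "I \<noteq> {}"
      using I(3) \<kappa> by auto
    then obtain s0 where s0: "s0 \<in> I"
      by blast
    have car: "\<phi> s \<in> mm_carrier X" "\<psi> s \<in> mm_carrier Y" if "s \<in> I" for s
      using that I(2) mm_parameter_in_carrier[OF X p(1)] mm_parameter_in_carrier[OF Y p(2)]
      by (meson subsetD)+
    interpret MY: Metric_space "mm_carrier Y" "mm_dist Y"
      by simp
    show ?thesis
      unfolding obs_diam_data_def[of X]
    proof (rule SUP_least)
      fix f :: "'a \<Rightarrow> real" assume f: "f \<in> lipschitz1 (mm_metric X) euclidean_metric"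
      define G where "G y s = f (\<phi> s) + mm_dist Y y (\<psi> s)" for y s
      define g where "g y = (INF s\<in>I. G y s)" for y
      have lower: "f (\<phi> t) - \<delta> - mm_dist Y y (\<psi> t) \<le> G y s"
        if "s \<in> I" "t \<in> I" "y \<in> mm_carrier Y" for s t y
      proof -
        have "\<bar>f (\<phi> s) - f (\<phi> t)\<bar> \<le> mm_dist X (\<phi> s) (\<phi> t)"
          using f car that by (simp add: lipschitz1_real_iff)
        moreover have "mm_dist Y (\<psi> s) (\<psi> t) \<le> mm_dist Y y (\<psi> s) + mm_dist Y y (\<psi> t)"
          using car that by (intro MY.triangle'')
        ultimately show ?thesis
          using d[OF that(1,2)] unfolding G_def by linarith
      qed
      have bdd: "bdd_below (G y ` I)" if "y \<in> mm_carrier Y" for y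
        using lower[OF _ s0 that] by (intro bdd_belowI2)
      have g: "g \<in> lipschitz1 (mm_metric Y) euclidean_metric"
      proof -
        have le: "g y - g z \<le> mm_dist Y y z" if yz: "y \<in> mm_carrier Y" "z \<in> mm_carrier Y" for y z
        proof -
          have "g y - mm_dist Y y z \<le> G z s" if s: "s \<in> I" for s
          proof -
            have "g y \<le> G y s"
              unfolding g_def using bdd[OF yz(1)] s by (rule cINF_lower)
            also have "\<dots> \<le> G z s + mm_dist Y y z"
              using MY.triangle[OF yz car(2)[OF s]] by (simp add: G_def)
            finally show ?thesis
              by simp
          qed
          then have "g y - mm_dist Y y z \<le> g z"
            unfolding g_def[of z] using \<open>I \<noteq> {}\<close> by (intro cINF_greatest)
          then show ?thesis
            by simp
        qed
        show ?thesis
          unfolding lipschitz1_real_iff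
        proof (intro ballI)
          fix y z assume "y \<in> mm_carrier Y" "z \<in> mm_carrier Y"
          then show "\<bar>g y - g z\<bar> \<le> mm_dist Y y z"
            using le[of y z] le[of z y] by (simp add: MY.commute abs_le_iff)
        qed
      qed
      have near: "f (\<phi> s) - \<delta> \<le> g (\<psi> s)" "g (\<psi> s) \<le> f (\<phi> s)" if s: "s \<in> I" for s
      proof -
        have "f (\<phi> s) - \<delta> \<le> G (\<psi> s) t" if "t \<in> I" for t
          using lower[OF that s car(2)[OF s]] by (simp add: car(2)[OF s])
        then show "f (\<phi> s) - \<delta> \<le> g (\<psi> s)"
          unfolding g_def using \<open>I \<noteq> {}\<close> by (intro cINF_greatest)
        have "g (\<psi> s) \<le> G (\<psi> s) s"
          unfolding g_def using bdd[OF car(2)[OF s]] s by (rule cINF_lower)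
        then show "g (\<psi> s) \<le> f (\<phi> s)"
          by (simp add: G_def car(2)[OF s])
      qed
      let ?\<mu> = "distr (mm_measure X) borel f" and ?\<nu> = "distr (mm_measure Y) borel g"
      have transfer: "part_diam euclidean_metric ?\<mu> (1 - (\<kappa> + \<delta>)) \<le> ennreal (e + \<delta>)"
        if e: "part_diam euclidean_metric ?\<nu> (1 - \<kappa>) < ennreal e" for e
      proof -
        interpret real_distribution ?\<nu>
          by (rule real_distribution_distr_lipschitz1[OF Y g])
        have e0: "0 \<le> e"
          using e by (metis ennreal_neg not_less_zero linorder_linear)
        obtain u where u: "1 - \<kappa> \<le> measure ?\<nu> {u..u + e}"
          using interval_if_part_diam_less[OF finite_measure_axioms _ _ e] False \<delta> by auto
        \<comment> \<open>Only the right endpoint moves, because \<open>g \<le> f\<close> along the parameters.\<close>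
        let ?A = "{s \<in> {0..1}. g (\<psi> s) \<in> {u..u + e}}" and ?B = "{s \<in> {0..1}. f (\<phi> s) \<in> {u..u + (e + \<delta>)}}"
        have mA: "1 - \<kappa> \<le> measure lborel ?A" "?A \<in> sets borel"
          using u measure_distr_parameter[OF Y p(2) g, of "{u..u + e}"] by simp_all
        have mB: "?B \<in> sets borel"
          by (rule measure_distr_parameter(2)[OF X p(1) f]) simp
        have fin: "S \<in> fmeasurable lborel" if "S \<in> sets borel" "S \<subseteq> {0..1::real}" for S
          using that by (intro fmeasurableI2[OF fmeasurable_cbox[of 0 1]]) (auto simp: cbox_interval)
        have AI: "measure lborel (?A \<union> I) = measure lborel ?A + measure lborel I - measure lborel (?A \<inter> I)"
          using I mA by (intro measure_Un3 fin) auto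
        have "measure lborel (?A \<union> I) \<le> measure lborel {0..1::real}"
          using I mA by (intro measure_mono_fmeasurable fin) auto
        then have "1 - (\<kappa> + \<delta>) \<le> measure lborel (?A \<inter> I)"
          using AI I(3) mA(1) by simp
        also have "\<dots> \<le> measure lborel ?B"
        proof (rule measure_mono_fmeasurable)
          show "?A \<inter> I \<subseteq> ?B"
          proof
            fix s assume s: "s \<in> ?A \<inter> I"
            then have "f (\<phi> s) - \<delta> \<le> g (\<psi> s)" "g (\<psi> s) \<le> f (\<phi> s)"
              using near by simp_all
            then show "s \<in> ?B"
              using s by auto
          qed
        qed (use I mA mB in \<open>auto intro: fin\<close>)
        also have "\<dots> = measure ?\<mu> {u..u + (e + \<delta>)}"
          by (rule measure_distr_parameter(1)[OF X p(1) f, symmetric]) simp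
        finally show ?thesis
          using e0 \<delta> by (intro part_diam_le_interval) auto
      qed
      have "part_diam euclidean_metric ?\<mu> (1 - (\<kappa> + \<delta>)) \<le> part_diam euclidean_metric ?\<nu> (1 - \<kappa>) + ennreal \<delta>"
      proof (rule ennreal_le_epsilon)
        fix \<eta> :: real assume \<eta>: "0 < \<eta>"
          and "part_diam euclidean_metric ?\<nu> (1 - \<kappa>) + ennreal \<delta> < top"
        then obtain r where r: "part_diam euclidean_metric ?\<nu> (1 - \<kappa>) = ennreal r" "0 \<le> r"
          by (cases "part_diam euclidean_metric ?\<nu> (1 - \<kappa>)") auto
        then have "part_diam euclidean_metric ?\<mu> (1 - (\<kappa> + \<delta>)) \<le> ennreal (r + \<eta> + \<delta>)"
          using \<eta> by (intro transfer) (simp add: ennreal_less_iff)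
        also have "\<dots> = part_diam euclidean_metric ?\<nu> (1 - \<kappa>) + ennreal \<delta> + ennreal \<eta>"
          using r \<eta> \<delta> by (simp add: ennreal_plus[symmetric] ac_simps del: ennreal_plus)
        finally show "part_diam euclidean_metric ?\<mu> (1 - (\<kappa> + \<delta>))
            \<le> part_diam euclidean_metric ?\<nu> (1 - \<kappa>) + ennreal \<delta> + ennreal \<eta>" .
      qed
      also have "\<dots> \<le> obs_diam_data Y \<kappa> + ennreal \<delta>"
        unfolding obs_diam_data_def using g by (intro add_right_mono SUP_upper)
      finally show "part_diam euclidean_metric ?\<mu> (1 - (\<kappa> + \<delta>)) \<le> obs_diam_data Y \<kappa> + ennreal \<delta>" .
    qed
  qed
qed

section \<open>Quantile functions\<close>

definition quantile :: "real measure \<Rightarrow> real \<Rightarrow> real" where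
  "quantile \<nu> s = Inf {x. s \<le> cdf \<nu> x}"

lemma (in real_distribution)
  shows quantile_le_iff: "\<lbrakk>0 < s; s < 1\<rbrakk> \<Longrightarrow> quantile M s \<le> x \<longleftrightarrow> s \<le> cdf M x"
    and quantile_mono: "\<lbrakk>0 < s; s \<le> t; t < 1\<rbrakk> \<Longrightarrow> quantile M s \<le> quantile M t"
    and quantile_measurable: "quantile M \<in> borel_measurable (restrict_space borel {0<..<1})"
    and distr_quantile: "distr (restrict_space lborel {0<..<1}) borel (quantile M) = M"
proof -
  interpret cdf_distribution M
    by unfold_locales
  have q: "quantile M = I"
    by (simp add: quantile_def fun_eq_iff)
  show "quantile M s \<le> x \<longleftrightarrow> s \<le> cdf M x" if "0 < s" "s < 1"
    using pseudoinverse[of s x] that by (simp add: q)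
  show "quantile M s \<le> quantile M t" if "0 < s" "s \<le> t" "t < 1"
    using mono_onD[OF mono_I, of s t] that by (simp add: q)
  show "quantile M \<in> borel_measurable (restrict_space borel {0<..<1})"
    unfolding q by (rule measurable_CI)
  show "distr (restrict_space lborel {0<..<1}) borel (quantile M) = M"
    unfolding q by (rule distr_I_eq_M)
qed

lemma (in real_distribution)
  assumes A: "A \<in> sets borel"
  shows emeasure_eq_quantile: "emeasure M A = emeasure lborel {s \<in> {0<..<1}. quantile M s \<in> A}"
    and quantile_vimage_borel: "{s \<in> {0<..<1}. quantile M s \<in> A} \<in> sets borel"
proof -
  let ?\<Omega> = "restrict_space lborel {0<..<1::real}"
  have qm: "quantile M \<in> ?\<Omega> \<rightarrow>\<^sub>M borel"
    using quantile_measurable by (simp cong: measurable_cong_sets add: sets_restrict_space)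
  have eq: "quantile M -` A \<inter> space ?\<Omega> = {s \<in> {0<..<1}. quantile M s \<in> A}"
    by (auto simp: space_restrict_space)
  have S: "quantile M -` A \<inter> space ?\<Omega> \<in> sets ?\<Omega>"
    using qm A by (rule measurable_sets)
  then show "{s \<in> {0<..<1}. quantile M s \<in> A} \<in> sets borel"
    unfolding eq by (subst (asm) sets_restrict_space_iff) auto
  have "emeasure M A = emeasure (distr ?\<Omega> borel (quantile M)) A"
    by (simp only: distr_quantile)
  also have "\<dots> = emeasure ?\<Omega> {s \<in> {0<..<1}. quantile M s \<in> A}"
    by (simp only: emeasure_distr[OF qm A] eq)
  also have "\<dots> = emeasure lborel {s \<in> {0<..<1}. quantile M s \<in> A}"
    by (rule emeasure_restrict_space) auto
  finally show "emeasure M A = emeasure lborel {s \<in> {0<..<1}. quantile M s \<in> A}" .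
qed

section \<open>Contraction to a bounded interval\<close>

text \<open>The points are the quantiles at the multiples of \<open>\<eta>\<close>. The quantile function pulls an interval of mass
more than \<open>\<eta>\<close> back to an interval of length more than \<open>\<eta>\<close>, and that contains such a multiple.\<close>

lemma (in real_distribution) finite_net_of_quantiles:
  assumes \<eta>: "0 < \<eta>" and N: "1 \<le> real N * \<eta>"
  obtains Q where "finite Q" "card Q \<le> N"
    and "\<And>J. \<lbrakk>is_interval J; J \<in> sets borel; \<eta> < measure M J\<rbrakk> \<Longrightarrow> J \<inter> Q \<noteq> {}"
proof
  let ?Q = "(\<lambda>i. quantile M (real i * \<eta>)) ` {1..N}"
  show "finite ?Q" "card ?Q \<le> N"
    using card_image_le[of "{1..N}" "\<lambda>i. quantile M (real i * \<eta>)"] by simp_all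
  fix J assume J: "is_interval J" "J \<in> sets borel" "\<eta> < measure M J"
  let ?K = "{s \<in> {0<..<1}. quantile M s \<in> J}"
  have K: "\<eta> < measure lborel ?K" "?K \<in> sets borel"
    using J emeasure_eq_quantile[of J] quantile_vimage_borel[of J] by (simp_all add: measure_def)
  have "\<exists>s\<in>?K. \<exists>t\<in>?K. \<eta> < t - s"
  proof (rule ccontr)
    assume "\<not> ?thesis"
    then have small: "\<And>s t. s \<in> ?K \<Longrightarrow> t \<in> ?K \<Longrightarrow> t - s \<le> \<eta>"
      by (meson not_less)
    have ne: "?K \<noteq> {}"
      using K(1) \<eta> by (metis less_asym measure_empty)
    have "?K \<subseteq> {Inf ?K..Inf ?K + \<eta>}"
    proof
      fix t assume t: "t \<in> ?K"
      have "t - \<eta> \<le> Inf ?K"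
      proof (rule cInf_greatest[OF ne])
        show "t - \<eta> \<le> s" if "s \<in> ?K" for s
          using small[OF that t] by simp
      qed
      moreover have "Inf ?K \<le> t"
        using t by (intro cInf_lower bdd_belowI[of _ 0]) auto
      ultimately show "t \<in> {Inf ?K..Inf ?K + \<eta>}"
        by simp
    qed
    then have "measure lborel ?K \<le> measure lborel {Inf ?K..Inf ?K + \<eta>}"
      using K(2) by (intro measure_mono_fmeasurable) (auto simp: fmeasurable_def emeasure_lborel_Icc_eq)
    then show False
      using K(1) \<eta> by simp
  qed
  then obtain s t where st: "s \<in> ?K" "t \<in> ?K" "\<eta> < t - s"
    by blast
  \<comment> \<open>The first multiple of \<open>\<eta>\<close> beyond \<open>s\<close>.\<close>
  define i where "i = nat \<lfloor>s / \<eta>\<rfloor> + 1"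
  have "0 \<le> s / \<eta>"
    using st \<eta> by simp
  then have i_real: "real i = of_int \<lfloor>s / \<eta>\<rfloor> + 1"
    by (simp add: i_def)
  then have "s / \<eta> < real i" "real i \<le> s / \<eta> + 1"
    by linarith+
  then have i: "s < real i * \<eta>" "real i * \<eta> \<le> s + \<eta>"
    using \<eta> by (simp_all add: field_simps)
  then have lt: "real i * \<eta> < t" "real i * \<eta> < 1"
    using st by auto
  then have "real i * \<eta> < real N * \<eta>"
    using N by linarith
  then have "i \<in> {1..N}"
    using \<eta> by (simp add: i_def)
  moreover have "quantile M s \<le> quantile M (real i * \<eta>)" "quantile M (real i * \<eta>) \<le> quantile M t"
    using st i lt by (intro quantile_mono; force)+
  then have "quantile M (real i * \<eta>) \<in> J"
    using st J(1) unfolding is_interval_1 by blast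
  ultimately show "J \<inter> ?Q \<noteq> {}"
    by blast
qed

lemma borel_measurable_nonexpansive:
  fixes h :: "real \<Rightarrow> real"
  assumes "\<And>x y. \<bar>h x - h y\<bar> \<le> \<bar>x - y\<bar>"
  shows "h \<in> borel_measurable borel"
proof -
  have "continuous_on UNIV h"
    using assms by (intro lipschitz_on_continuous_on[of 1] lipschitz_onI) (auto simp: dist_real_def)
  then show ?thesis
    by (rule borel_measurable_continuous_onI)
qed

text \<open>Let \<open>Q\<close> be a finite net of quantiles and let \<open>E\<close> consist of the intervals of length \<open>c + 1\<close> to the
right of the points of \<open>Q\<close>. The map \<open>h\<close> measures the part of \<open>E\<close> to the left of a point; thus it
moves with unit speed on \<open>E\<close> and is constant on the gaps, and its range is bounded by the length of \<open>E\<close>.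
If two points of \<open>Q\<close> have images at distance at most \<open>c\<close>, there is no gap between them, since
before a gap all of an interval of length \<open>c + 1\<close> would have been traversed; so their distance has not
changed. The preimage of an interval of length \<open>c\<close> therefore either misses \<open>Q\<close> or consists of a part of length
at most \<open>c\<close> between two points of \<open>Q\<close> and of two ends that miss \<open>Q\<close> and have mass at most \<open>\<eta>\<close> each.\<close>

lemma (in real_distribution) bounded_contraction:
  assumes \<eta>: "0 < \<eta>" and N: "1 \<le> real N * \<eta>" and c: "0 \<le> c"
    and large: "ennreal c < part_diam euclidean_metric M \<alpha>"
  shows "\<exists>h :: real \<Rightarrow> real. (\<forall>x y. \<bar>h x - h y\<bar> \<le> \<bar>x - y\<bar>) \<and> (\<forall>x. 0 \<le> h x \<and> h x \<le> real N * (c + 1)) \<and>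
           ennreal c \<le> part_diam euclidean_metric (distr M borel h) (\<alpha> + 2 * \<eta>)"
proof -
  obtain Q where Q: "finite Q" "card Q \<le> N"
    "\<And>J. \<lbrakk>is_interval J; J \<in> sets borel; \<eta> < measure M J\<rbrakk> \<Longrightarrow> J \<inter> Q \<noteq> {}"
    using finite_net_of_quantiles[OF \<eta> N] by blast
  have \<alpha>: "0 < \<alpha>"
    using large part_diam_nonpos[of \<alpha> euclidean_metric M] by (force simp: not_less[symmetric])
  have short: "measure M {q..q + c} < \<alpha>" for q
    using large part_diam_le_interval[of M c \<alpha> q] c by (force simp: not_less[symmetric])
  define E where "E = (\<Union>q\<in>Q. {q..q + (c + 1)})"
  define h where "h x = measure lborel (E \<inter> {..x})" for x
  have E: "E \<in> sets borel"
    unfolding E_def using Q(1) by (intro borel_closed closed_UN) auto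
  have "E \<in> fmeasurable lborel"
    unfolding E_def using Q(1) by (intro fmeasurable.finite_UN) (auto simp: fmeasurable_def emeasure_lborel_Icc_eq)
  then have fin: "E \<inter> A \<in> fmeasurable lborel" if "A \<in> sets borel" for A
    using that by (intro fmeasurable_Int_fmeasurable) auto
  have diff: "h y - h x = measure lborel (E \<inter> {x<..y})" if "x \<le> y" for x y
  proof -
    have "E \<inter> {..y} = (E \<inter> {..x}) \<union> (E \<inter> {x<..y})"
      using that by auto
    then have "h y = measure lborel ((E \<inter> {..x}) \<union> (E \<inter> {x<..y}))"
      by (simp add: h_def)
    also have "\<dots> = h x + measure lborel (E \<inter> {x<..y})"
      proof -
      have "(E \<inter> {..x}) \<inter> (E \<inter> {x<..y}) = {}"
        by auto
      then show ?thesis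
        using measure_Un3[OF fin[of "{..x}"] fin[of "{x<..y}"]] by (simp only: h_def) simp
    qed
    finally show ?thesis
      by simp
  qed
  have mono: "h x \<le> h y" and Lip: "h y - h x \<le> y - x" if "x \<le> y" for x y
  proof -
    show "h x \<le> h y"
      using diff[OF that] measure_nonneg[of lborel "E \<inter> {x<..y}"] by linarith
    have "measure lborel (E \<inter> {x<..y}) \<le> measure lborel {x<..y}"
      using E that by (intro measure_mono_fmeasurable) (auto simp: fmeasurable_def)
    then show "h y - h x \<le> y - x"
      using diff[OF that] that by simp
  qed
  have lip: "\<bar>h x - h y\<bar> \<le> \<bar>x - y\<bar>" for x y
    using mono[of x y] mono[of y x] Lip[of x y] Lip[of y x] by (cases "x \<le> y") auto
  have hm[measurable]: "h \<in> borel_measurable borel"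
    using lip by (rule borel_measurable_nonexpansive)
  have range: "0 \<le> h x \<and> h x \<le> real N * (c + 1)" for x
  proof
    show "0 \<le> h x"
      by (simp add: h_def)
    have "h x \<le> measure lborel E"
      unfolding h_def using fin[of UNIV] E by (intro measure_mono_fmeasurable) auto
    also have "\<dots> \<le> (\<Sum>q\<in>Q. measure lborel {q..q + (c + 1)})"
      unfolding E_def using Q(1) by (intro measure_UNION_le) auto
    also have "\<dots> = real (card Q) * (c + 1)"
      using c by simp
    also have "\<dots> \<le> real N * (c + 1)"
      using Q(2) c by (intro mult_right_mono) auto
    finally show "h x \<le> real N * (c + 1)" .
  qed
  \<comment> \<open>The intervals of \<open>E\<close> are longer than \<open>c\<close>, so a gap after \<open>q\<close> is preceded by too much of \<open>E\<close>.\<close>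
  have uncontracted: "q' - q \<le> c" if q: "q \<in> Q" "q \<le> q'" and hq: "h q' - h q \<le> c" for q q'
  proof (cases "{q<..q'} \<subseteq> E")
    case True
    then have "E \<inter> {q<..q'} = {q<..q'}"
      by blast
    then show ?thesis
      using diff[OF q(2)] hq q(2) by simp
  next
    case False
    then obtain z where "z \<in> {q<..q'}" and "z \<notin> E"
      by blast
    then have z: "q < z" "z \<le> q'" "z \<notin> E"
      by simp_all
    then have "q + (c + 1) < z"
      using q(1) unfolding E_def by (force simp: not_le[symmetric])
    then have "{q<..q + (c + 1)} \<subseteq> E \<inter> {q<..q'}"
      using z(2) unfolding E_def by (intro subsetI IntI UN_I[OF q(1)]) auto
    then have "measure lborel {q<..q + (c + 1)} \<le> measure lborel (E \<inter> {q<..q'})"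
      using fin by (intro measure_mono_fmeasurable) auto
    then show ?thesis
      using diff[OF q(2)] hq c by simp
  qed
  have light: "measure M K < \<alpha> + 2 * \<eta>"
    if K: "is_interval K" "K \<in> sets borel" and hK: "\<And>x y. x \<in> K \<Longrightarrow> y \<in> K \<Longrightarrow> h y - h x \<le> c" for K
  proof (cases "K \<inter> Q = {}")
    case True
    then have "measure M K \<le> \<eta>"
      using Q(3) K by (meson not_less)
    then show ?thesis
      using \<alpha> \<eta> by linarith
  next
    case False
    define q q' where "q = Min (K \<inter> Q)" and "q' = Max (K \<inter> Q)"
    have q: "q \<in> K \<inter> Q" "q' \<in> K \<inter> Q"
      using False Q(1) Min_in[of "K \<inter> Q"] Max_in[of "K \<inter> Q"] by (simp_all add: q_def q'_def)
    have ext: "q \<le> p" "p \<le> q'" if "p \<in> K \<inter> Q" for p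
      using that Q(1) by (simp_all add: q_def q'_def)
    have "is_interval (K \<inter> {..<q})" "is_interval (K \<inter> {q'<..})"
      by (intro is_interval_Int K(1) is_interval_io is_interval_oi)+
    moreover have "(K \<inter> {..<q}) \<inter> Q = {}" "(K \<inter> {q'<..}) \<inter> Q = {}"
      using ext by (meson Int_iff disjoint_iff greaterThan_iff lessThan_iff not_less)+
    moreover have "K \<inter> {..<q} \<in> sets borel" "K \<inter> {q'<..} \<in> sets borel"
      using K(2) by auto
    ultimately have ends: "measure M (K \<inter> {..<q}) \<le> \<eta>" "measure M (K \<inter> {q'<..}) \<le> \<eta>"
      using Q(3) by (meson not_less)+
    have "q' \<le> q + c"
      using uncontracted[of q q'] hK[of q q'] q ext(1)[OF q(2)] by simp
    then have "K \<subseteq> (K \<inter> {..<q}) \<union> {q..q + c} \<union> (K \<inter> {q'<..})"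
      by auto
    then have "measure M K \<le> measure M ((K \<inter> {..<q}) \<union> {q..q + c} \<union> (K \<inter> {q'<..}))"
      using K(2) by (intro finite_measure_mono) auto
    also have "\<dots> \<le> measure M ((K \<inter> {..<q}) \<union> {q..q + c}) + measure M (K \<inter> {q'<..})"
      using K(2) by (intro measure_Un_le) auto
    also have "measure M ((K \<inter> {..<q}) \<union> {q..q + c}) \<le> measure M (K \<inter> {..<q}) + measure M {q..q + c}"
      using K(2) by (intro measure_Un_le) auto
    finally show ?thesis
      using ends short[of q] by linarith
  qed
  have "ennreal c \<le> part_diam euclidean_metric (distr M borel h) (\<alpha> + 2 * \<eta>)"
  proof (rule ccontr)
    assume "\<not> ?thesis"
    then have less: "part_diam euclidean_metric (distr M borel h) (\<alpha> + 2 * \<eta>) < ennreal c"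
      by simp
    interpret D: prob_space "distr M borel h"
      by (rule prob_space_distr) simp
    obtain u where "\<alpha> + 2 * \<eta> \<le> measure (distr M borel h) {u..u + c}"
      using interval_if_part_diam_less[OF D.finite_measure_axioms _ _ less] \<alpha> \<eta> by auto
    also have "\<dots> = measure M (h -` {u..u + c})"
      by (subst measure_distr) simp_all
    also have "\<dots> < \<alpha> + 2 * \<eta>"
    proof (rule light)
      show "is_interval (h -` {u..u + c})"
        unfolding is_interval_1
      proof (intro ballI allI impI)
        fix x y z assume "x \<in> h -` {u..u + c}" "y \<in> h -` {u..u + c}" "x \<le> z \<and> z \<le> y"
        then show "z \<in> h -` {u..u + c}"
          using mono[of x z] mono[of z y] by simp
      qed
      show "h -` {u..u + c} \<in> sets borel"
        using measurable_sets[OF hm, of "{u..u + c}"] by simp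
    qed auto
    finally show False
      by simp
  qed
  then show ?thesis
    using lip range by blast
qed

section \<open>Laws on the line as mm-spaces\<close>

text \<open>An mm-space has full support, so the law of a function gives rise to an mm-space only on its support.\<close>

definition msupport :: "real measure \<Rightarrow> real set" where
  "msupport \<nu> = {x. \<forall>U. open U \<longrightarrow> x \<in> U \<longrightarrow> 0 < emeasure \<nu> U}"

lemma closed_msupport: "closed (msupport \<nu>)"
proof -
  have "- msupport \<nu> = \<Union> {U. open U \<and> emeasure \<nu> U = 0}"
    by (auto simp: msupport_def zero_less_iff_neq_zero)
  moreover have "open (\<Union> {U. open U \<and> emeasure \<nu> U = 0})"
    by blast
  ultimately show ?thesis
    by (simp add: closed_def)
qed

lemma msupport_borel: "msupport \<nu> \<in> sets borel"
  by (rule borel_closed[OF closed_msupport])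

lemma (in real_distribution) AE_msupport: "AE x in M. x \<in> msupport M"
proof -
  obtain B :: "real set set" where B: "countable B" "topological_basis B"
    using ex_countable_basis by blast
  have "- msupport M \<subseteq> \<Union> {U \<in> B. emeasure M U = 0}"
  proof
    fix x assume "x \<in> - msupport M"
    then obtain U where U: "open U" "x \<in> U" "emeasure M U = 0"
      by (auto simp: msupport_def zero_less_iff_neq_zero)
    then obtain V where V: "V \<in> B" "x \<in> V" "V \<subseteq> U"
      using B(2) topological_basisE by blast
    then have "emeasure M V \<le> emeasure M U"
      using U(1) by (intro emeasure_mono) auto
    then show "x \<in> \<Union> {U \<in> B. emeasure M U = 0}"
      using U(3) V by auto
  qed
  moreover have "(\<Union>U\<in>{U \<in> B. emeasure M U = 0}. U) \<in> null_sets M"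
  proof (rule null_sets_UN')
    show "countable {U \<in> B. emeasure M U = 0}"
      using B(1) by (rule countable_subset[rotated]) blast
    show "U \<in> null_sets M" if "U \<in> {U \<in> B. emeasure M U = 0}" for U
      using that topological_basis_open[OF B(2)] by (auto intro!: null_setsI)
  qed
  ultimately show ?thesis
    by (intro AE_I'[of "\<Union> {U \<in> B. emeasure M U = 0}"]) auto
qed

lemma (in real_distribution) msupport_nonempty: "msupport M \<noteq> {}"
proof
  assume "msupport M = {}"
  then have "AE x in M. False"
    using AE_msupport by simp
  then show False
    by simp
qed

definition real_mm :: "real measure \<Rightarrow> real mm_data" where
  "real_mm \<nu> = MM (submetric euclidean_metric (msupport \<nu>)) (restrict_space \<nu> (msupport \<nu>))"

lemma real_mm_simps [simp]:
  "mm_carrier (real_mm \<nu>) = msupport \<nu>"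
  "mm_dist (real_mm \<nu>) = dist"
  "mm_measure (real_mm \<nu>) = restrict_space \<nu> (msupport \<nu>)"
  "mm_topology (real_mm \<nu>) = top_of_set (msupport \<nu>)"
  by (simp_all add: real_mm_def mtopology_of_submetric)

lemma (in real_distribution) emeasure_restrict_msupport:
  assumes "A \<in> sets borel"
  shows "emeasure (restrict_space M (msupport M)) (A \<inter> msupport M) = emeasure M A"
proof -
  note S = msupport_borel[of M]
  have "emeasure (restrict_space M (msupport M)) (A \<inter> msupport M) = emeasure M (A \<inter> msupport M)"
    using S assms by (intro emeasure_restrict_space) auto
  also have "\<dots> = emeasure M A"
    using AE_msupport S assms by (intro emeasure_eq_AE) auto
  finally show ?thesis .
qed

lemma (in real_distribution) mm_space_real_mm: "mm_space (real_mm M)"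
  unfolding mm_space_def
proof (intro conjI allI impI)
  let ?S = "msupport M"
  note S = msupport_borel[of M]
  interpret Submetric UNIV dist ?S
    by unfold_locales simp
  have "Met_TC.mcomplete TYPE(real)"
    by (simp add: mcomplete_iff_complete complete_UNIV)
  then have "sub.mcomplete"
    using closedin_eq_mcomplete closed_msupport by simp
  then show "mcomplete_of (mm_metric (real_mm M))"
    by (simp add: mcomplete_of_def)
  obtain T where "countable T" "T \<subseteq> ?S" "?S \<subseteq> closure T"
    using separable by blast
  then show "separable_space (mm_topology (real_mm M))"
    unfolding separable_space_def by (auto simp: closure_of_subtopology Int_absorb1 intro!: exI[of _ T])
  have "sets (restrict_space M ?S) = (\<inter>) ?S ` sigma_sets UNIV {U. open U}"
    by (simp add: sets_restrict_space borel_def)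
  also have "\<dots> = sigma_sets ?S ((\<inter>) ?S ` {U. open U})"
    using S by (intro sigma_sets_Int) (simp_all add: borel_def)
  also have "(\<inter>) ?S ` {U. open U} = {U. openin (top_of_set ?S) U}"
    by (auto simp: openin_open)
  also have "sigma_sets ?S \<dots> = sets (borel_of (top_of_set ?S))"
    unfolding borel_of_def by (subst sets_measure_of) (auto dest: openin_imp_subset)
  finally show "sets (mm_measure (real_mm M)) = sets (borel_of (mm_topology (real_mm M)))"
    by simp
  show "prob_space (mm_measure (real_mm M))"
    using emeasure_restrict_msupport[of UNIV] emeasure_space_1
    by (intro prob_spaceI) (simp add: space_restrict_space)
  fix U assume U: "openin (mm_topology (real_mm M)) U \<and> U \<noteq> {}"
  then obtain V where V: "open V" "U = V \<inter> ?S"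
    by (auto simp: openin_open)
  then have "emeasure (restrict_space M ?S) U = emeasure M V"
    by (simp add: emeasure_restrict_msupport)
  then show "0 < emeasure (mm_measure (real_mm M)) U"
    using U V by (auto simp: msupport_def)
qed

lemma (in real_distribution) distr_restrict_msupport:
  assumes f: "f \<in> N \<rightarrow>\<^sub>M borel" and M: "distr N borel f = M"
    and range: "\<And>x. x \<in> space N \<Longrightarrow> f x \<in> msupport M"
  shows "f \<in> N \<rightarrow>\<^sub>M restrict_space M (msupport M)"
    and "distr N (restrict_space M (msupport M)) f = restrict_space M (msupport M)"
proof -
  let ?R = "restrict_space M (msupport M)"
  note S = msupport_borel[of M]
  show fR: "f \<in> N \<rightarrow>\<^sub>M ?R"
    using f range by (intro measurable_restrict_space2) (auto cong: measurable_cong_sets)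
  show "distr N ?R f = ?R"
  proof (rule measure_eqI)
    fix A assume "A \<in> sets (distr N ?R f)"
    then have A: "A \<in> sets ?R"
      by simp
    then obtain B where B: "B \<in> sets borel" "A = B \<inter> msupport M"
      by (auto simp: sets_restrict_space)
    have "f -` A \<inter> space N = f -` B \<inter> space N"
      using range B(2) by auto
    then have "emeasure (distr N ?R f) A = emeasure (distr N borel f) B"
      using fR f A B by (simp add: emeasure_distr)
    then show "emeasure (distr N ?R f) A = emeasure ?R A"
      using B by (simp add: M emeasure_restrict_msupport)
  qed simp
qed

text \<open>Full support of \<open>X\<close> is what makes \<open>f\<close> take all its values, and not only almost all of them, in the
support of its law.\<close>

lemma real_mm_dominated:
  assumes X: "mm_space X" and f: "f \<in> lipschitz1 (mm_metric X) (euclidean_metric :: real metric)"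
  shows "lip_dominated (real_mm (distr (mm_measure X) borel f)) X"
proof -
  let ?\<nu> = "distr (mm_measure X) borel f"
  interpret \<nu>: real_distribution ?\<nu>
    by (rule real_distribution_distr_lipschitz1[OF X f])
  have fm: "f \<in> mm_measure X \<rightarrow>\<^sub>M borel"
    by (rule lipschitz1_measurable_real[OF X f])
  have range: "f x \<in> msupport ?\<nu>" if x: "x \<in> mm_carrier X" for x
    unfolding msupport_def
  proof (intro CollectI allI impI)
    fix U assume U: "open U" "f x \<in> U"
    have "openin (mm_topology X) {y \<in> mm_carrier X. f y \<in> U}"
      using lipschitz1_continuous[OF f] U(1) by (simp add: continuous_map_def)
    then have "0 < emeasure (mm_measure X) {y \<in> mm_carrier X. f y \<in> U}"
      using X x U(2) by (auto simp: mm_space_def)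
    also have "{y \<in> mm_carrier X. f y \<in> U} = f -` U \<inter> space (mm_measure X)"
      by (auto simp: space_mm_measure[OF X])
    finally show "0 < emeasure ?\<nu> U"
      using U(1) fm by (simp add: emeasure_distr)
  qed
  have "f \<in> lipschitz1 (mm_metric X) (mm_metric (real_mm ?\<nu>))"
    using f range by (simp add: lipschitz1_def)
  moreover have "distr (mm_measure X) (mm_measure (real_mm ?\<nu>)) f = mm_measure (real_mm ?\<nu>)"
    using \<nu>.distr_restrict_msupport(2)[OF fm refl] range by (simp add: space_mm_measure[OF X])
  ultimately show ?thesis
    unfolding lip_dominated_def by blast
qed

lemma (in real_distribution) part_diam_le_obs_diam_real_mm:
  "part_diam euclidean_metric M (1 - \<kappa>) \<le> obs_diam_data (real_mm M) \<kappa>"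
proof -
  have id: "(\<lambda>x. x) \<in> lipschitz1 (mm_metric (real_mm M)) (euclidean_metric :: real metric)"
    by (simp add: lipschitz1_def)
  have "distr (restrict_space M (msupport M)) borel (\<lambda>x. x) = M"
  proof (rule measure_eqI)
    fix A assume "A \<in> sets (distr (restrict_space M (msupport M)) borel (\<lambda>x. x))"
    then have "A \<in> sets borel"
      by simp
    then show "emeasure (distr (restrict_space M (msupport M)) borel (\<lambda>x. x)) A = emeasure M A"
      using lipschitz1_measurable_real[OF mm_space_real_mm id]
      by (simp add: emeasure_distr space_restrict_space emeasure_restrict_msupport)
  qed simp
  then show ?thesis
    unfolding obs_diam_data_def using id by (auto intro!: SUP_upper2)
qed

section \<open>Box convergence of bounded laws\<close>

lemma AE_lborel_01_interior: "AE s in lborel_01. 0 < s \<and> s < 1"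
proof -
  have "AE s in lborel. s \<in> {0..1::real} \<longrightarrow> 0 < s \<and> s < 1"
    using AE_lborel_singleton[of "0::real"] AE_lborel_singleton[of "1::real"] by eventually_elim auto
  then show ?thesis
    by (subst AE_restrict_space_iff) auto
qed

lemma prob_space_lborel_01: "prob_space lborel_01"
  by (rule prob_spaceI) (simp add: space_restrict_space emeasure_restrict_space)

text \<open>The quantile function itself is not quite a parameter: its values at the endpoints
of the unit interval are arbitrary, and a parameter has to take its values in the support everywhere. Both
are repaired on a null set.\<close>

lemma (in real_distribution) quantile_parameter:
  obtains \<phi> where "mm_parameter (real_mm M) \<phi>" "\<phi> \<in> borel_measurable lborel_01"
    and "AE s in lborel_01. \<phi> s = quantile M s"
proof -
  define q where "q s = (if s \<in> {0<..<1} then quantile M s else 0)" for s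
  have "q \<in> borel_measurable borel"
    unfolding q_def using quantile_measurable by (subst (asm) measurable_restrict_space_iff) auto
  then have q: "q \<in> borel_measurable lborel_01"
    by (intro measurable_restrict_space1) simp
  have distr_q: "distr lborel_01 borel q = M"
  proof (rule measure_eqI)
    fix A assume "A \<in> sets (distr lborel_01 borel q)"
    then have A: "A \<in> sets borel"
      by simp
    have "emeasure (distr lborel_01 borel q) A = emeasure lborel (q -` A \<inter> {0..1})"
      using q A by (simp add: emeasure_distr space_restrict_space emeasure_restrict_space)
    also have "\<dots> = emeasure lborel {s \<in> {0<..<1}. quantile M s \<in> A}"
    proof (rule emeasure_eq_AE)
      show "AE s in lborel. s \<in> q -` A \<inter> {0..1} \<longleftrightarrow> s \<in> {s \<in> {0<..<1}. quantile M s \<in> A}"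
        using AE_lborel_singleton[of "0::real"] AE_lborel_singleton[of "1::real"]
        by eventually_elim (auto simp: q_def)
      show "q -` A \<inter> {0..1} \<in> sets lborel"
        using \<open>q \<in> borel_measurable borel\<close> A by (auto intro: measurable_sets_borel)
    qed (use quantile_vimage_borel[OF A] in simp)
    finally show "emeasure (distr lborel_01 borel q) A = emeasure M A"
      by (simp add: emeasure_eq_quantile[OF A])
  qed simp
  note S = msupport_borel[of M]
  have "AE x in distr lborel_01 borel q. x \<in> msupport M"
    unfolding distr_q by (rule AE_msupport)
  then have AE_q: "AE s in lborel_01. q s \<in> msupport M"
    using q S by (subst (asm) AE_distr_iff) auto
  obtain x0 where x0: "x0 \<in> msupport M"
    using msupport_nonempty by blast
  define \<phi> where "\<phi> s = (if q s \<in> msupport M then q s else x0)" for s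
  have \<phi>: "\<phi> \<in> borel_measurable lborel_01"
    unfolding \<phi>_def using q S by measurable
  have "distr lborel_01 borel \<phi> = distr lborel_01 borel q"
    using AE_q q \<phi> by (intro distr_cong_AE) (auto simp: \<phi>_def elim: eventually_mono)
  then have "distr lborel_01 borel \<phi> = M"
    by (simp add: distr_q)
  then have "mm_parameter (real_mm M) \<phi>"
    unfolding mm_parameter_def real_mm_simps using distr_restrict_msupport[OF \<phi>] x0
    by (auto simp: \<phi>_def)
  moreover have "AE s in lborel_01. \<phi> s = quantile M s"
    using AE_q AE_lborel_01_interior by eventually_elim (simp add: \<phi>_def q_def)
  ultimately show ?thesis
    using that \<phi> by blast
qed

text \<open>For a continuity point \<open>x\<close> of the limit cdf, almost every \<open>s\<close> satisfies \<open>quantile (\<mu> n) s \<le> x\<close> for all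
large \<open>n\<close> if and only if \<open>quantile M s \<le> x\<close>; the only exception is \<open>s = cdf M x\<close>. A countable
dense set \<open>D\<close> of continuity points then has only a null set of exceptions, and it determines the limit.\<close>

lemma weak_conv_quantile:
  assumes \<mu>: "\<And>n. real_distribution (\<mu> n)" and M: "real_distribution M"
    and conv: "weak_conv_m \<mu> M"
  shows "AE s in lborel_01. (\<lambda>n. quantile (\<mu> n) s) \<longlonglongrightarrow> quantile M s"
proof -
  interpret \<mu>: real_distribution "\<mu> n" for n
    by (rule \<mu>)
  interpret M: real_distribution M
    by (rule M)
  have "\<exists>x\<in>{p<..<q}. measure M {x} = 0" if "p < q" for p q
    using open_minus_countable[OF M.countable_support, of "{p<..<q}"] that by auto
  then obtain X where X: "\<And>p q. p < q \<Longrightarrow> X p q \<in> {p<..<q} \<and> measure M {X p q} = 0"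
    by metis
  define D where "D = (\<lambda>(p, q). X p q) ` {(p, q). p \<in> \<rat> \<and> q \<in> \<rat> \<and> p < q}"
  have "countable ({(p, q). p \<in> \<rat> \<and> q \<in> \<rat> \<and> p < q} :: (real \<times> real) set)"
    by (rule countable_subset[of _ "\<rat> \<times> \<rat>"]) (auto simp: countable_rat)
  then have D: "countable D"
    unfolding D_def by (rule countable_image)
  have cont: "(\<lambda>n. cdf (\<mu> n) x) \<longlonglongrightarrow> cdf M x" if "x \<in> D" for x
    using conv that X unfolding weak_conv_m_def weak_conv_def D_def by (auto simp: M.isCont_cdf)
  have dense: "\<exists>x\<in>D. a < x \<and> x < b" if ab: "a < b" for a b
  proof -
    obtain p where p: "p \<in> \<rat>" "a < p" "p < b"
      using Rats_dense_in_real[OF ab] by blast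
    obtain q where q: "q \<in> \<rat>" "p < q" "q < b"
      using Rats_dense_in_real[OF p(3)] by blast
    have "X p q \<in> D"
      unfolding D_def using p q by (intro image_eqI[of _ _ "(p, q)"]) auto
    then show ?thesis
      using X[OF q(2)] p q by (intro bexI[of _ "X p q"]) auto
  qed
  have "cdf M ` D \<in> null_sets lborel"
    using D by (intro countable_imp_null_set_lborel countable_image)
  then have "AE s in lborel. s \<notin> cdf M ` D"
    by (rule AE_not_in)
  then have "AE s in lborel_01. s \<notin> cdf M ` D"
    by (subst AE_restrict_space_iff) auto
  then show ?thesis
    using AE_lborel_01_interior
  proof eventually_elim
    case (elim s)
    show ?case
    proof (rule order_tendstoI)
      fix a assume "a < quantile M s"
      then obtain x where x: "x \<in> D" "a < x" "x < quantile M s"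
        using dense by blast
      then have "cdf M x < s"
        using M.quantile_le_iff[of s x] elim by (simp add: not_le[symmetric])
      with cont[OF x(1)] have "eventually (\<lambda>n. cdf (\<mu> n) x < s) sequentially"
        by (rule order_tendstoD)
      then show "eventually (\<lambda>n. a < quantile (\<mu> n) s) sequentially"
      proof eventually_elim
        case (elim n)
        then show ?case
          using \<mu>.quantile_le_iff[of s n x] x(2) \<open>s \<notin> cdf M ` D \<close> \<open>0 < s \<and> s < 1\<close> by linarith
      qed
    next
      fix b assume "quantile M s < b"
      then obtain x where x: "x \<in> D" "quantile M s < x" "x < b"
        using dense by blast
      then have "s \<le> cdf M x"
        using M.quantile_le_iff[of s x] elim by simp
      then have "s < cdf M x"
        using elim x(1) by (metis image_eqI order_le_less)
      with cont[OF x(1)] have "eventually (\<lambda>n. s < cdf (\<mu> n) x) sequentially"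
        by (rule order_tendstoD)
      then show "eventually (\<lambda>n. quantile (\<mu> n) s < b) sequentially"
      proof eventually_elim
        case (elim n)
        then show ?case
          using \<mu>.quantile_le_iff[of s n x] x(3) \<open>0 < s \<and> s < 1\<close> by linarith
      qed
    qed
  qed
qed

lemma weak_conv_imp_box_close:
  assumes \<mu>: "\<And>n. real_distribution (\<mu> n)" and M: "real_distribution M"
    and conv: "weak_conv_m \<mu> M" and \<delta>: "0 < \<delta>"
  shows "eventually (\<lambda>n. box_close (real_mm M) (real_mm (\<mu> n)) \<delta>) sequentially"
proof -
  interpret \<Omega>: prob_space lborel_01
    by (rule prob_space_lborel_01)
  obtain \<phi> where \<phi>: "mm_parameter (real_mm M) \<phi>" "AE s in lborel_01. \<phi> s = quantile M s"
    and [measurable]: "\<phi> \<in> borel_measurable lborel_01"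
    using real_distribution.quantile_parameter[OF M] by metis
  have "\<exists>\<psi>. mm_parameter (real_mm (\<mu> n)) \<psi> \<and> \<psi> \<in> borel_measurable lborel_01 \<and>
      (AE s in lborel_01. \<psi> s = quantile (\<mu> n) s)" for n
    using real_distribution.quantile_parameter[OF \<mu>] by metis
  then obtain \<psi> where \<psi>: "\<And>n. mm_parameter (real_mm (\<mu> n)) (\<psi> n)"
      "\<And>n. AE s in lborel_01. \<psi> n s = quantile (\<mu> n) s"
    and [measurable]: "\<And>n. \<psi> n \<in> borel_measurable lborel_01"
    by metis
  define I where "I n = {s \<in> {0..1}. \<bar>\<phi> s - \<psi> n s\<bar> \<le> \<delta> / 2}" for n
  have I_eq: "I n = {s \<in> space lborel_01. \<bar>\<phi> s - \<psi> n s\<bar> \<le> \<delta> / 2}" for n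
    by (simp add: I_def space_restrict_space)
  have I[measurable]: "I n \<in> sets lborel_01" for n
    unfolding I_eq by measurable
  have "AE s in lborel_01. \<forall>n. \<psi> n s = quantile (\<mu> n) s"
    using \<psi>(2) by (simp add: AE_all_countable)
  then have "AE s in lborel_01. (\<lambda>n. indicator (I n) s :: real) \<longlonglongrightarrow> 1"
    using \<phi>(2) weak_conv_quantile[OF \<mu> M conv] AE_space
  proof eventually_elim
    case (elim s)
    then have "(\<lambda>n. \<psi> n s) \<longlonglongrightarrow> \<phi> s"
      by simp
    then have "eventually (\<lambda>n. dist (\<psi> n s) (\<phi> s) < \<delta> / 2) sequentially"
      using \<delta> by (intro tendstoD) auto
    then have "eventually (\<lambda>n. \<bar>\<phi> s - \<psi> n s\<bar> \<le> \<delta> / 2) sequentially"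
      by eventually_elim (unfold dist_real_def, argo)
    then have "eventually (\<lambda>n. indicator (I n) s = (1::real)) sequentially"
      by eventually_elim (use elim(4) in \<open>simp add: I_eq\<close>)
    then show ?case
      by (rule tendsto_eventually)
  qed
  then have "(\<lambda>n. \<integral>s. indicator (I n) s \<partial>lborel_01) \<longlonglongrightarrow> (\<integral>s. (1::real) \<partial>lborel_01)"
    by (intro integral_dominated_convergence[where w = "\<lambda>_. 1"]) auto
  then have "(\<lambda>n. measure lborel_01 (I n)) \<longlonglongrightarrow> 1"
    using I sets.sets_into_space[OF I] \<Omega>.prob_space by (simp add: Int_absorb2 space_restrict_space)
  then have "eventually (\<lambda>n. 1 - \<delta> < measure lborel_01 (I n)) sequentially"
    using \<delta> by (intro order_tendstoD) auto
  then show ?thesis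
  proof eventually_elim
    case (elim n)
    show ?case
      unfolding box_close_def
    proof (intro exI conjI ballI)
      show "I n \<in> sets borel"
        using I[of n] by (subst (asm) sets_restrict_space_iff) auto
      have "measure lborel_01 (I n) = measure lborel (I n)"
        by (intro measure_restrict_space) (auto simp: I_def)
      then show "1 - \<delta> \<le> measure lborel (I n)"
        using elim by simp
      show "\<bar>mm_dist (real_mm M) (\<phi> s) (\<phi> t) - mm_dist (real_mm (\<mu> n)) (\<psi> n s) (\<psi> n t)\<bar> \<le> \<delta>"
        if "s \<in> I n" "t \<in> I n" for s t
        using that unfolding I_def real_mm_simps dist_real_def by simp argo
    qed (use \<phi>(1) \<psi>(1) in \<open>auto simp: I_def\<close>)
  qed
qed

text \<open>Laws on a fixed bounded interval are tight, so Helly's selection theorem applies to them.\<close>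

lemma bounded_laws_box_convergent_subsequence:
  fixes \<mu> :: "nat \<Rightarrow> real measure"
  assumes \<mu>: "\<And>n. real_distribution (\<mu> n)" and bdd: "\<And>n. measure (\<mu> n) {0..L} = 1"
  obtains r M where "strict_mono r" "real_distribution M"
    and "\<And>\<delta>. 0 < \<delta> \<Longrightarrow> eventually (\<lambda>n. box_close (real_mm M) (real_mm (\<mu> (r n))) \<delta>) sequentially"
proof -
  interpret \<mu>: real_distribution "\<mu> n" for n
    by (rule \<mu>)
  have "measure (\<mu> n) {-1<..max L 0} = 1" for n
  proof -
    have "measure (\<mu> n) {0..L} \<le> measure (\<mu> n) {-1<..max L 0}"
      by (intro \<mu>.finite_measure_mono) auto
    then show ?thesis
      using bdd[of n] \<mu>.prob_le_1[of n "{-1<..max L 0}"] by linarith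
  qed
  then have "tight \<mu>"
    unfolding tight_def using \<mu> by (intro conjI allI impI exI[of _ "-1"] exI[of _ "max L 0"]) auto
  then obtain r M where r: "strict_mono r" "real_distribution M" "weak_conv_m (\<mu> \<circ> id \<circ> r) M"
    using tight_imp_convergent_subsubsequence[of \<mu> id] by (auto simp: strict_mono_def)
  show ?thesis
    using weak_conv_imp_box_close[of "\<mu> \<circ> id \<circ> r" M] r \<mu> that[OF r(1,2)] by simp
qed

section \<open>Observable diameter of isomorphism classes\<close>

lemma mm_space_rep: "mm_space (rep_mm_class X)"
  using Quotient3_rep_reflp[OF Quotient3_mm_class, of X] by (simp add: mm_equiv_def)

lemma mm_equiv_refl: "mm_space X \<Longrightarrow> mm_equiv X X"
  by (simp add: mm_equiv_def mm_isomorphic_refl)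

lemma obs_diam_antimono:
  assumes "\<kappa> \<le> \<kappa>'"
  shows "obs_diam X \<kappa>' \<le> obs_diam X \<kappa>"
  unfolding obs_diam.rep_eq by (rule obs_diam_data_antimono[OF assms])

lemma obs_diam_box_dist:
  assumes "box_dist X Y < ennreal \<delta>" "0 \<le> \<kappa>"
  shows "obs_diam X (\<kappa> + \<delta>) \<le> obs_diam Y \<kappa> + ennreal \<delta>"
proof -
  obtain \<epsilon> where \<epsilon>: "0 \<le> \<epsilon>" "box_close (rep_mm_class X) (rep_mm_class Y) \<epsilon>" "\<epsilon> < \<delta>"
    using assms(1) unfolding box_dist.rep_eq box_dist_data_def INF_less_iff
    by (auto simp: ennreal_less_iff)
  have "obs_diam X (\<kappa> + \<delta>) \<le> obs_diam X (\<kappa> + \<epsilon>)"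
    using \<epsilon> by (intro obs_diam_antimono) simp
  also have "\<dots> \<le> obs_diam Y \<kappa> + ennreal \<epsilon>"
    unfolding obs_diam.rep_eq
    by (rule obs_diam_data_box_close[OF mm_space_rep mm_space_rep \<epsilon>(2,1) assms(2)])
  also have "\<dots> \<le> obs_diam Y \<kappa> + ennreal \<delta>"
    using \<epsilon> by (intro add_left_mono ennreal_leI) simp
  finally show ?thesis .
qed

lemma obs_diam_right_continuous:
  assumes c: "0 \<le> c" "ennreal c < obs_diam X \<kappa>"
  shows "\<exists>\<epsilon>>0. ennreal c < obs_diam X (\<kappa> + \<epsilon>)"
proof -
  let ?X = "rep_mm_class X"
  obtain f :: "real \<Rightarrow> real" where f: "f \<in> lipschitz1 (mm_metric ?X) euclidean_metric"
    "ennreal c < part_diam euclidean_metric (distr (mm_measure ?X) borel f) (1 - \<kappa>)"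
    using c(2) unfolding obs_diam.rep_eq obs_diam_data_def less_SUP_iff by blast
  interpret real_distribution "distr (mm_measure ?X) borel f"
    by (rule real_distribution_distr_lipschitz1[OF mm_space_rep f(1)])
  obtain \<epsilon> where \<epsilon>: "0 < \<epsilon>"
      "ennreal c < part_diam euclidean_metric (distr (mm_measure ?X) borel f) (1 - \<kappa> - \<epsilon>)"
    using part_diam_left_continuous[OF c(1), of "1 - \<kappa>"] f(2) by (meson not_less)
  note \<epsilon>(2)
  also have "part_diam euclidean_metric (distr (mm_measure ?X) borel f) (1 - \<kappa> - \<epsilon>) \<le> obs_diam X (\<kappa> + \<epsilon>)"
    unfolding obs_diam.rep_eq obs_diam_data_def diff_diff_eq using f(1) by (rule SUP_upper)
  finally show ?thesis
    using \<epsilon>(1) by blast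
qed

text \<open>A large observable diameter is already witnessed, up to \<open>2 * \<eta>\<close> in the level, by a dominated
law on an interval whose length does not depend on \<open>X\<close>. This uniformity is what makes compactness available.\<close>

lemma bounded_law_dominated:
  assumes \<eta>: "0 < \<eta>" and N: "1 \<le> real N * \<eta>" and c: "0 \<le> c" "ennreal c < obs_diam X \<kappa>"
  shows "\<exists>\<nu>. real_distribution \<nu> \<and> measure \<nu> {0..real N * (c + 1)} = 1 \<and>
           abs_mm_class (real_mm \<nu>) \<prec>\<^sub>L X \<and> ennreal c \<le> obs_diam (abs_mm_class (real_mm \<nu>)) (\<kappa> - 2 * \<eta>)"
proof -
  let ?X = "rep_mm_class X"
  have X: "mm_space ?X"
    by (rule mm_space_rep)
  obtain f :: "real \<Rightarrow> real" where f: "f \<in> lipschitz1 (mm_metric ?X) euclidean_metric"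
    "ennreal c < part_diam euclidean_metric (distr (mm_measure ?X) borel f) (1 - \<kappa>)"
    using c(2) unfolding obs_diam.rep_eq obs_diam_data_def less_SUP_iff by blast
  interpret f: real_distribution "distr (mm_measure ?X) borel f"
    by (rule real_distribution_distr_lipschitz1[OF X f(1)])
  obtain h :: "real \<Rightarrow> real" where lip: "\<And>x y. \<bar>h x - h y\<bar> \<le> \<bar>x - y\<bar>"
    and range: "\<And>x. 0 \<le> h x \<and> h x \<le> real N * (c + 1)"
    and h: "ennreal c \<le> part_diam euclidean_metric
              (distr (distr (mm_measure ?X) borel f) borel h) (1 - \<kappa> + 2 * \<eta>)"
    using f.bounded_contraction[OF \<eta> N c(1) f(2)] by blast
  have hL: "h \<in> lipschitz1 euclidean_metric euclidean_metric"
    using lip by (simp add: lipschitz1_def dist_real_def)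
  have hm: "h \<in> borel_measurable borel"
    using lip by (rule borel_measurable_nonexpansive)
  define \<nu> where "\<nu> = distr (mm_measure ?X) borel (h \<circ> f)"
  have hf: "h \<circ> f \<in> lipschitz1 (mm_metric ?X) euclidean_metric"
    by (rule lipschitz1_comp[OF f(1) hL])
  interpret \<nu>: real_distribution \<nu>
    unfolding \<nu>_def by (rule real_distribution_distr_lipschitz1[OF X hf])
  have Y: "mm_space (real_mm \<nu>)"
    by (rule \<nu>.mm_space_real_mm)
  have "(h \<circ> f) -` {0..real N * (c + 1)} \<inter> space (mm_measure ?X) = space (mm_measure ?X)"
    using range by auto
  then have "measure \<nu> {0..real N * (c + 1)} = measure (mm_measure ?X) (space (mm_measure ?X))"
    unfolding \<nu>_def using lipschitz1_measurable_real[OF X hf] by (simp add: measure_distr)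
  also have "\<dots> = 1"
    using X by (simp add: mm_space_def prob_space.prob_space)
  finally have "measure \<nu> {0..real N * (c + 1)} = 1" .
  moreover have "abs_mm_class (real_mm \<nu>) \<prec>\<^sub>L X"
  proof -
    have "lip_dominated (real_mm \<nu>) ?X"
      unfolding \<nu>_def by (rule real_mm_dominated[OF X hf])
    then have "abs_mm_class (real_mm \<nu>) \<prec>\<^sub>L abs_mm_class ?X"
      using dominated.abs_eq[OF mm_equiv_refl[OF Y] mm_equiv_refl[OF X]] by simp
    then show ?thesis
      by (simp add: Quotient3_abs_rep[OF Quotient3_mm_class])
  qed
  moreover have "ennreal c \<le> obs_diam (abs_mm_class (real_mm \<nu>)) (\<kappa> - 2 * \<eta>)"
  proof -
    have "\<nu> = distr (distr (mm_measure ?X) borel f) borel h"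
      unfolding \<nu>_def by (rule distr_distr[OF hm lipschitz1_measurable_real[OF X f(1)], symmetric])
    then have "ennreal c \<le> part_diam euclidean_metric \<nu> (1 - (\<kappa> - 2 * \<eta>))"
      using h by (simp add: algebra_simps)
    also have "\<dots> \<le> obs_diam_data (real_mm \<nu>) (\<kappa> - 2 * \<eta>)"
      by (rule \<nu>.part_diam_le_obs_diam_real_mm)
    finally show ?thesis
      by (simp add: obs_diam.abs_eq[OF mm_equiv_refl[OF Y]])
  qed
  ultimately show ?thesis
    using \<nu>.real_distribution_axioms by blast
qed

lemma box_dist_le_if_box_close:
  assumes "mm_space X" "mm_space Y" "box_close X Y \<delta>" "0 \<le> \<delta>"
  shows "box_dist (abs_mm_class X) (abs_mm_class Y) \<le> ennreal \<delta>"
proof -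
  have "box_dist (abs_mm_class X) (abs_mm_class Y) = box_dist_data X Y"
    using assms(1,2) by (intro box_dist.abs_eq mm_equiv_refl)
  also have "\<dots> \<le> ennreal \<delta>"
    unfolding box_dist_data_def by (rule INF_lower) (intro CollectI conjI assms(3,4))
  finally show ?thesis .
qed

lemma box_dist_sym: "box_dist X Y = box_dist Y X"
  unfolding box_dist.rep_eq by (rule box_dist_data_sym)

section \<open>The limit formula\<close>

lemma pyramid_downward:
  assumes "pyramid P" "Y \<in> P" "X \<prec>\<^sub>L Y"
  shows "X \<in> P"
proof -
  have "\<forall>X Y. Y \<in> P \<and> X \<prec>\<^sub>L Y \<longrightarrow> X \<in> P"
    using assms(1) unfolding pyramid_def by (elim conjE)
  then show ?thesis
    using assms(2,3) by iprover
qed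

text \<open>The passage from \<open>\<epsilon>\<^sub>0\<close> to \<open>\<epsilon> < \<epsilon>\<^sub>0\<close> leaves room in the level for the box distance
between \<open>X\<close> and its approximants.\<close>

lemma weakly_converges_obs_diam_lower:
  assumes conv: "weakly_converges Pn P" and \<kappa>: "0 \<le> \<kappa>" and c: "ennreal c < pyramid_obs_diam P \<kappa>" "0 \<le> c"
  shows "\<exists>\<epsilon>\<^sub>0>0. \<forall>\<epsilon>. 0 < \<epsilon> \<longrightarrow> \<epsilon> < \<epsilon>\<^sub>0 \<longrightarrow>
           eventually (\<lambda>n. ennreal c \<le> pyramid_obs_diam (Pn n) (\<kappa> + \<epsilon>)) sequentially"
proof -
  obtain X where X: "X \<in> P" "ennreal c < obs_diam X \<kappa>"
    using c unfolding pyramid_obs_diam_def less_SUP_iff by blast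
  obtain b where b: "ennreal c < b" "b < obs_diam X \<kappa>"
    using dense[OF X(2)] by blast
  then obtain c' where c': "b = ennreal c'" "0 \<le> c'"
    by (cases b) auto
  then have cc': "c < c'"
    using b c by (simp add: ennreal_less_iff)
  obtain \<epsilon>\<^sub>0 where \<epsilon>\<^sub>0: "0 < \<epsilon>\<^sub>0" "ennreal c' < obs_diam X (\<kappa> + \<epsilon>\<^sub>0)"
    using obs_diam_right_continuous[of c' X \<kappa>] b c' by blast
  have "eventually (\<lambda>n. ennreal c \<le> pyramid_obs_diam (Pn n) (\<kappa> + \<epsilon>)) sequentially"
    if \<epsilon>: "0 < \<epsilon>" "\<epsilon> < \<epsilon>\<^sub>0" for \<epsilon>
  proof -
    define \<delta> where "\<delta> = min (\<epsilon>\<^sub>0 - \<epsilon>) (c' - c)"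
    have \<delta>: "0 < \<delta>" "\<epsilon> + \<delta> \<le> \<epsilon>\<^sub>0" "c + \<delta> \<le> c'"
      using \<epsilon> cc' by (auto simp: \<delta>_def)
    have "(\<lambda>n. box_dist_set X (Pn n)) \<longlonglongrightarrow> 0"
      using conv X(1) by (simp add: weakly_converges_def)
    then have "eventually (\<lambda>n. box_dist_set X (Pn n) < ennreal \<delta>) sequentially"
      using \<delta>(1) by (intro order_tendstoD) auto
    then show ?thesis
    proof eventually_elim
      case (elim n)
      then obtain Y where Y: "Y \<in> Pn n" "box_dist X Y < ennreal \<delta>"
        unfolding box_dist_set_def INF_less_iff by blast
      have "ennreal c + ennreal \<delta> \<le> ennreal c'"
        using \<delta> c by (simp add: ennreal_plus[symmetric] del: ennreal_plus)
      also have "\<dots> \<le> obs_diam X (\<kappa> + \<epsilon>\<^sub>0)"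
        using \<epsilon>\<^sub>0(2) by simp
      also have "\<dots> \<le> obs_diam X (\<kappa> + \<epsilon> + \<delta>)"
        using \<delta>(2) by (intro obs_diam_antimono) simp
      also have "\<dots> \<le> obs_diam Y (\<kappa> + \<epsilon>) + ennreal \<delta>"
        using Y(2) \<kappa> \<epsilon>(1) by (intro obs_diam_box_dist) auto
      finally have "ennreal c \<le> obs_diam Y (\<kappa> + \<epsilon>)"
        by (simp add: ennreal_add_left_cancel_le add.commute)
      also have "\<dots> \<le> pyramid_obs_diam (Pn n) (\<kappa> + \<epsilon>)"
        unfolding pyramid_obs_diam_def using Y(1) by (rule SUP_upper)
      finally show ?case .
    qed
  qed
  then show ?thesis
    using \<epsilon>\<^sub>0(1) by blast
qed

text \<open>If the inequality failed, the spaces of bounded laws that witness this along a subsequence would have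
a box limit. The limit lies in \<open>P\<close>, because its box distance to \<open>Pn n\<close> has lower limit zero, and stability
gives it too large an observable diameter.\<close>

lemma weakly_converges_obs_diam_upper:
  assumes pyr: "\<And>n. 1 \<le> n \<Longrightarrow> pyramid (Pn n)" and conv: "weakly_converges Pn P"
    and \<kappa>: "0 \<le> \<kappa>" and \<epsilon>: "0 < \<epsilon>"
  shows "limsup (\<lambda>n. pyramid_obs_diam (Pn n) (\<kappa> + \<epsilon>)) \<le> pyramid_obs_diam P \<kappa>"
proof (rule ccontr)
  assume "\<not> ?thesis"
  then obtain b where b: "pyramid_obs_diam P \<kappa> < b" "b < limsup (\<lambda>n. pyramid_obs_diam (Pn n) (\<kappa> + \<epsilon>))"
    using dense unfolding not_le by blast
  then obtain c where c: "b = ennreal c" "0 \<le> c"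
    by (cases b) auto
  obtain d where d: "pyramid_obs_diam P \<kappa> = ennreal d" "0 \<le> d" "d < c"
    using b(1) c by (cases "pyramid_obs_diam P \<kappa>") (auto simp: ennreal_less_iff)
  let ?A = "{n. 1 \<le> n \<and> ennreal c < pyramid_obs_diam (Pn n) (\<kappa> + \<epsilon>)}"
  \<comment> \<open>Only the \<open>Pn n\<close> with \<open>1 \<le> n\<close> are known to be pyramids.\<close>
  have "infinite ?A"
  proof
    assume "finite ?A"
    then obtain m where m: "\<forall>n\<in>?A. n < m"
      using finite_nat_set_iff_bounded by blast
    have "eventually (\<lambda>n. pyramid_obs_diam (Pn n) (\<kappa> + \<epsilon>) \<le> ennreal c) sequentially"
      using eventually_ge_at_top[of "max m 1"]
    proof eventually_elim
      case (elim n)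
      then have "n \<notin> ?A"
        using m by (meson leD max.bounded_iff)
      then show ?case
        using elim by (simp add: not_less)
    qed
    then have "limsup (\<lambda>n. pyramid_obs_diam (Pn n) (\<kappa> + \<epsilon>)) \<le> ennreal c"
      by (rule Limsup_bounded)
    then show False
      using b(2) c(1) by simp
  qed
  define r where "r = enumerate ?A"
  have r: "strict_mono r" "\<And>k. r k \<in> ?A"
    unfolding r_def by (rule strict_mono_enumerate enumerate_in_set, fact)+
  \<comment> \<open>The net has mesh \<open>\<epsilon> / 4\<close> because the contraction costs twice the mesh in the level.\<close>
  obtain N :: nat where "4 / \<epsilon> \<le> real N"
    using real_arch_simple by blast
  then have N: "1 \<le> real N * (\<epsilon> / 4)"
    using \<epsilon> by (simp add: field_simps)
  have quarter: "0 < \<epsilon> / 4"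
    using \<epsilon> by simp
  have "\<exists>\<nu>. real_distribution \<nu> \<and> measure \<nu> {0..real N * (c + 1)} = 1 \<and>
      abs_mm_class (real_mm \<nu>) \<in> Pn (r k) \<and> ennreal c \<le> obs_diam (abs_mm_class (real_mm \<nu>)) (\<kappa> + \<epsilon> / 2)" for k
  proof -
    obtain X where X: "X \<in> Pn (r k)" "ennreal c < obs_diam X (\<kappa> + \<epsilon>)"
      using r(2)[of k] unfolding pyramid_obs_diam_def less_SUP_iff by blast
    have down: "Y \<in> Pn (r k)" if "Y \<prec>\<^sub>L X" for Y
      using r(2)[of k] pyr by (intro pyramid_downward[OF _ X(1) that]) simp
    have half: "\<kappa> + \<epsilon> - 2 * (\<epsilon> / 4) = \<kappa> + \<epsilon> / 2"
      by simp
    obtain \<nu> where "real_distribution \<nu>" "measure \<nu> {0..real N * (c + 1)} = 1"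
        "abs_mm_class (real_mm \<nu>) \<prec>\<^sub>L X" "ennreal c \<le> obs_diam (abs_mm_class (real_mm \<nu>)) (\<kappa> + \<epsilon> / 2)"
      using bounded_law_dominated[OF quarter N c(2) X(2), unfolded half] by blast
    then show ?thesis
      using down by blast
  qed
  then obtain \<nu> where \<nu>: "\<And>k. real_distribution (\<nu> k)" "\<And>k. measure (\<nu> k) {0..real N * (c + 1)} = 1"
    "\<And>k. abs_mm_class (real_mm (\<nu> k)) \<in> Pn (r k)"
    "\<And>k. ennreal c \<le> obs_diam (abs_mm_class (real_mm (\<nu> k))) (\<kappa> + \<epsilon> / 2)"
    by metis
  obtain s M where s: "strict_mono s" "real_distribution M"
    "\<And>\<delta>. 0 < \<delta> \<Longrightarrow> eventually (\<lambda>k. box_close (real_mm M) (real_mm (\<nu> (s k))) \<delta>) sequentially"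
    by (rule bounded_laws_box_convergent_subsequence[of \<nu>, OF \<nu>(1,2)])
      (rule that, assumption, assumption, blast)
  let ?Y = "abs_mm_class (real_mm M)" and ?Z = "\<lambda>k. abs_mm_class (real_mm (\<nu> (s k)))"
  have close: "eventually (\<lambda>k. box_dist ?Y (?Z k) \<le> ennreal \<delta>) sequentially" if "0 < \<delta>" for \<delta>
    using s(3)[OF that]
  proof eventually_elim
    case (elim k)
    then show ?case
      using that by (intro box_dist_le_if_box_close real_distribution.mm_space_real_mm s(2) \<nu>(1)) auto
  qed
  \<comment> \<open>A positive lower limit would keep the spaces of \<open>Pn (r (s k))\<close> away from \<open>?Y\<close>.\<close>
  have "?Y \<in> P"
  proof (rule ccontr)
    assume "?Y \<notin> P"
    then have "0 < liminf (\<lambda>n. box_dist_set ?Y (Pn n))"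
      using conv by (simp add: weakly_converges_def)
    then obtain a where a: "0 < a" "a < liminf (\<lambda>n. box_dist_set ?Y (Pn n))"
      using dense by blast
    then obtain a' where a': "a = ennreal a'" "0 < a'"
      by (cases a) auto
    have "eventually (\<lambda>n. a < box_dist_set ?Y (Pn n)) sequentially"
      using a(2) by (rule less_LiminfD)
    moreover have "filterlim (r \<circ> s) sequentially sequentially"
      using r(1) s(1) by (intro filterlim_subseq strict_mono_o)
    ultimately have "eventually (\<lambda>k. a < box_dist_set ?Y (Pn ((r \<circ> s) k))) sequentially"
      by (rule eventually_compose_filterlim)
    then have "eventually (\<lambda>k::nat. False) sequentially"
      using close[OF a'(2)]
    proof eventually_elim
      case (elim k)
      have "box_dist_set ?Y (Pn (r (s k))) \<le> box_dist ?Y (?Z k)"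
        unfolding box_dist_set_def using \<nu>(3) by (rule INF_lower)
      then show ?case
        using elim a'(1) by simp
    qed
    then show False
      by simp
  qed
  define \<delta> where "\<delta> = min (\<epsilon> / 2) ((c - d) / 2)"
  have \<delta>: "0 < \<delta>" "\<delta> \<le> \<epsilon> / 2"
    using \<epsilon> d(3) by (simp_all add: \<delta>_def)
  have "\<delta> \<le> (c - d) / 2"
    unfolding \<delta>_def by (rule min.cobounded2)
  then have "d + \<delta> < c"
    using d(3) by argo
  obtain k where "box_dist ?Y (?Z k) \<le> ennreal (\<delta> / 2)"
    using eventually_happens'[OF sequentially_bot close[of "\<delta> / 2"]] \<delta>(1) by auto
  also have "\<dots> < ennreal \<delta>"
    using \<delta>(1) by (simp add: ennreal_less_iff)
  finally have "box_dist (?Z k) ?Y < ennreal \<delta>"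
    by (simp add: box_dist_sym)
  then have "obs_diam (?Z k) (\<kappa> + \<delta>) \<le> obs_diam ?Y \<kappa> + ennreal \<delta>"
    using \<kappa> by (rule obs_diam_box_dist)
  also have "obs_diam ?Y \<kappa> \<le> ennreal d"
    unfolding d(1)[symmetric] pyramid_obs_diam_def using \<open>?Y \<in> P\<close> by (rule SUP_upper)
  finally have "obs_diam (?Z k) (\<kappa> + \<delta>) \<le> ennreal (d + \<delta>)"
    using d(2) \<delta>(1) by simp
  also have "\<dots> < ennreal c"
    using \<open>d + \<delta> < c\<close> d(2) \<delta>(1) by (intro ennreal_lessI) linarith+
  also have "ennreal c \<le> obs_diam (?Z k) (\<kappa> + \<epsilon> / 2)"
    by (rule \<nu>(4))
  also have "\<dots> \<le> obs_diam (?Z k) (\<kappa> + \<delta>)"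
    using \<delta>(2) by (intro obs_diam_antimono) simp
  finally show False
    by simp
qed

theorem theorem1p1:
  fixes P :: "mm_class set" and Pn :: "nat \<Rightarrow> mm_class set" and \<kappa> :: real
  assumes "pyramid P"
    and "\<And>n. 1 \<le> n \<Longrightarrow> pyramid (Pn n)"
    and "0 < \<kappa>"
    and "weakly_converges Pn P"
  shows "((\<lambda>\<epsilon>. liminf (\<lambda>n. pyramid_obs_diam (Pn n) (\<kappa> + \<epsilon>)))
            \<longlongrightarrow> pyramid_obs_diam P \<kappa>) (at_right 0)
       \<and> ((\<lambda>\<epsilon>. limsup (\<lambda>n. pyramid_obs_diam (Pn n) (\<kappa> + \<epsilon>)))
            \<longlongrightarrow> pyramid_obs_diam P \<kappa>) (at_right 0)"
proof -
  let ?lo = "\<lambda>\<epsilon>. liminf (\<lambda>n. pyramid_obs_diam (Pn n) (\<kappa> + \<epsilon>))"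
  let ?hi = "\<lambda>\<epsilon>. limsup (\<lambda>n. pyramid_obs_diam (Pn n) (\<kappa> + \<epsilon>))"
  have \<kappa>: "0 \<le> \<kappa>"
    using assms(3) by simp
  have lo_hi: "?lo \<epsilon> \<le> ?hi \<epsilon>" for \<epsilon>
    by (rule Liminf_le_Limsup) simp
  have hi: "eventually (\<lambda>\<epsilon>. ?hi \<epsilon> \<le> pyramid_obs_diam P \<kappa>) (at_right 0)"
    using weakly_converges_obs_diam_upper[OF assms(2,4) \<kappa>]
    by (auto intro!: eventually_at_rightI[of 0 1])
  have lo: "eventually (\<lambda>\<epsilon>. a < ?lo \<epsilon>) (at_right 0)" if a: "a < pyramid_obs_diam P \<kappa>" for a
  proof -
    obtain b where b: "a < b" "b < pyramid_obs_diam P \<kappa>"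
      using dense[OF a] by blast
    then obtain c where c: "b = ennreal c" "0 \<le> c"
      by (cases b) auto
    obtain \<epsilon>\<^sub>0 where \<epsilon>\<^sub>0: "0 < \<epsilon>\<^sub>0" "\<And>\<epsilon>. \<lbrakk>0 < \<epsilon>; \<epsilon> < \<epsilon>\<^sub>0\<rbrakk> \<Longrightarrow>
        eventually (\<lambda>n. b \<le> pyramid_obs_diam (Pn n) (\<kappa> + \<epsilon>)) sequentially"
      using weakly_converges_obs_diam_lower[OF assms(4) \<kappa> _ c(2)] b(2) c(1) by blast
    have "a < ?lo \<epsilon>" if "\<epsilon> \<in> {0<..<\<epsilon>\<^sub>0}" for \<epsilon>
      using b(1) Liminf_bounded[OF \<epsilon>\<^sub>0(2)[of \<epsilon>]] that by (auto intro: less_le_trans)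
    then show ?thesis
      using \<epsilon>\<^sub>0(1) by (rule eventually_at_rightI)
  qed
  show ?thesis
  proof (intro conjI order_tendstoI)
    fix a assume a: "a < pyramid_obs_diam P \<kappa>"
    show "eventually (\<lambda>\<epsilon>. a < ?lo \<epsilon>) (at_right 0)"
      by (rule lo[OF a])
    show "eventually (\<lambda>\<epsilon>. a < ?hi \<epsilon>) (at_right 0)"
      using lo[OF a] by eventually_elim (rule less_le_trans[OF _ lo_hi])
  next
    fix a assume a: "pyramid_obs_diam P \<kappa> < a"
    show "eventually (\<lambda>\<epsilon>. ?hi \<epsilon> < a) (at_right 0)"
      using hi by eventually_elim (rule le_less_trans[OF _ a])
    show "eventually (\<lambda>\<epsilon>. ?lo \<epsilon> < a) (at_right 0)"
      using hi by eventually_elim (rule le_less_trans[OF order_trans[OF lo_hi] a])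
  qed
qed

end
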